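(* Let $n,k\in\mathbb Z$ and let $D$ be a diagram of an ordered oriented virtual 2-component link. Then $\operatorname{span}_{n,k}(D)$ is an ordered oriented virtual 2-component link invariant and $\operatorname{fspan}_{n,k}(D)$ is an ordered oriented flat virtual 2-component link invariant.
   Context: Diagrams. A virtual link diagram is a 4-regular plane diagram of immersed oriented circles in which every vertex is marked as a classical crossing (with over/under information) or as a virtual crossing; a 2-component diagram is ordered if its components are labelled $1$ and $2$. Generalized Reidemeister moves are the classical moves RI, RII, RIII, the virtual moves VRI, VRII, VRIII, and the move SV, in which a strand having two virtual crossings with the two strands of a classical crossing is moved across that crossing (all orientations; labels respected). Ordered oriented virtual links are diagrams modulo these moves; ordered oriented flat virtual links are diagrams modulo these moves and crossing changes (switching over and under at a classical crossing). Sign and index. Draw a classical crossing $c$ with both strands directed upward. $\operatorname{sgn}(c)=+1$ if the overstrand runs from bottom left to top right, and $-1$ otherwise. For an oriented virtual knot diagram $E$, label the arcs (edges of the 4-regular graph) by integers so that at each classical crossing, if the incoming bottom-left and bottom-right arcs are labelled $a$ and $b$, then the outgoing top-left and top-right arcs are labelled $b+1$ and $a-1$; labels do not change along a strand through a virtual crossing. Then $\operatorname{Ind}(c)=\operatorname{sgn}(c)(a-b-1)$. Put $J_n(E)=\sum_{c:\operatorname{Ind}(c)=n}\operatorname{sgn}(c)$ and $\nabla J_n(E)=J_n(E)-J_{-n}(E)$ (so $\nabla J_0=0$). Type-3 smoothing. Let $c$ be a classical crossing of a 2-component diagram $D=K_1\cup K_2$ at which $K_1$ and $K_2$ meet. ${}^cD$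 is the oriented virtual knot diagram obtained by removing $c$, joining the two incoming ends at $c$ to each other and the two outgoing ends to each other, and reversing the orientation of one of the two components. Which component keeps its orientation depends only on over/under information (always the component passing over at $c$, or always the one passing under), a convention fixed once for all crossings. Span. Let $O(D)$ (respectively $U(D)$) be the set of classical crossings of $D$ at which $K_1$ passes over (respectively under) $K_2$, and let $I_{n,k}$ be the set of crossings $c$ between $K_1$ and $K_2$ with $\nabla J_n({}^cD)=k$. Then $$\operatorname{span}_{n,k}(D)=\sum_{c\in O(D)\cap I_{n,k}}\operatorname{sgn}(c)-\sum_{c\in U(D)\cap I_{n,k}}\operatorname{sgn}(c),\qquad \operatorname{fspan}_{n,k}(D)=\operatorname{span}_{n,k}(D)+\operatorname{span}_{n,-k}(D).$$ *)

theory Defs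
  imports Main
begin

section \<open>Plane diagrams\<close>

text \<open>
  A diagram is encoded by its plane graph with named oriented arcs and named faces.
  A crossing is drawn with both strands directed upward, and
  \<open>Crossing k a b c d\<close> has incoming arcs \<open>a\<close> (bottom left), \<open>b\<close> (bottom right)
  and outgoing arcs \<open>c\<close> (top left), \<open>d\<close> (top right); its strands run from \<open>a\<close> to
  \<open>d\<close> and from \<open>b\<close> to \<open>c\<close>.  \<open>OverL\<close> says that the strand entering at the bottom left
  passes over, \<open>OverR\<close> that the one entering at the bottom right does.

  \<open>Point a b\<close> is a point in the interior of an edge, subdividing it into \<open>a\<close>
  followed by \<open>b\<close>.  Points are not vertices of the 4-regular graph: they are inserted and
  deleted freely (see \<open>subdivides\<close> below), they represent circles without crossings
  (\<open>Point a a\<close>), and they mark the strands on which a move acts.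
\<close>

type_synonym arc = nat
type_synonym face = nat

datatype kind = Virtual | OverL | OverR

datatype vert = Point arc arc | Crossing kind arc arc arc arc

datatype component = K1 | K2

fun ins :: "vert \<Rightarrow> arc list" where
  "ins (Point a b) = [a]"
| "ins (Crossing k a b c d) = [a, b]"

fun outs :: "vert \<Rightarrow> arc list" where
  "outs (Point a b) = [b]"
| "outs (Crossing k a b c d) = [c, d]"

fun classical :: "vert \<Rightarrow> bool" where
  "classical (Point a b) \<longleftrightarrow> False"
| "classical (Crossing k a b c d) \<longleftrightarrow> k \<noteq> Virtual"

text \<open>\<open>lface D a\<close> and \<open>rface D a\<close> are the faces to the left and right of the arc \<open>a\<close>;
  \<open>outer D\<close> is the unbounded face.\<close>

record diagram =
  verts :: "vert set"
  lab :: "arc \<Rightarrow> component"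
  lface :: "arc \<Rightarrow> face"
  rface :: "arc \<Rightarrow> face"
  outer :: face

definition arcs_of :: "vert set \<Rightarrow> arc set" where
  "arcs_of V = (\<Union>v\<in>V. set (ins v) \<union> set (outs v))"

abbreviation arcs :: "diagram \<Rightarrow> arc set" where
  "arcs D \<equiv> arcs_of (verts D)"

definition faces :: "diagram \<Rightarrow> face set" where
  "faces D = lface D ` arcs D \<union> rface D ` arcs D"

text \<open>Every arc leaves exactly one vertex and enters exactly one vertex.\<close>

definition arcs_matched :: "vert set \<Rightarrow> bool" where
  "arcs_matched V \<longleftrightarrow>
     (\<forall>v\<in>V. distinct (ins v) \<and> distinct (outs v)) \<and>
     (\<forall>a\<in>arcs_of V. (\<exists>!v. v \<in> V \<and> a \<in> set (ins v)) \<and> (\<exists>!v. v \<in> V \<and> a \<in> set (outs v)))"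

fun passes :: "vert \<Rightarrow> (arc \<times> arc) set" where
  "passes (Point a b) = {(a, b)}"
| "passes (Crossing k a b c d) = {(a, d), (b, c)}"

definition two_components :: "diagram \<Rightarrow> bool" where
  "two_components D \<longleftrightarrow>
     lab D ` arcs D = {K1, K2} \<and>
     (\<forall>a\<in>arcs D. \<forall>b\<in>arcs D. lab D a = lab D b \<longleftrightarrow> (a, b) \<in> (\<Union>v\<in>verts D. passes v)\<^sup>*)"

text \<open>The four quadrants at a crossing (left, bottom, right, top) lie in one face each.\<close>

fun corners_agree :: "diagram \<Rightarrow> vert \<Rightarrow> bool" where
  "corners_agree D (Point a b) \<longleftrightarrow> lface D a = lface D b \<and> rface D a = rface D b"
| "corners_agree D (Crossing k a b c d) \<longleftrightarrow>
     lface D a = lface D c \<and> rface D a = lface D b \<and>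
     rface D b = rface D d \<and> rface D c = lface D d"

text \<open>Two arcs are related if they lie in the same connected component of the graph.\<close>

definition graph_connected :: "diagram \<Rightarrow> (arc \<times> arc) set" where
  "graph_connected D =
     (\<Union>v\<in>verts D. (set (ins v) \<union> set (outs v)) \<times> (set (ins v) \<union> set (outs v)))\<^sup>*"

text \<open>
  The graph may be disconnected, and then the faces also record how its parts are placed
  relative to each other.  Let \<open>C\<close> be the number of connected components and \<open>g\<close> the
  sum of their genera.  Their boundary walks, of which there are
  \<open>2 * C - 2 * g - card (verts D) + card (arcs D)\<close>, are the edges of an incidence graph
  between components and faces, with \<open>C + card (faces D)\<close> nodes.  This graph is connected
  because the dual graph is, so Euler's formula below forces \<open>g = 0\<close> and the incidence
  graph to be a tree, which is what an embedding in the sphere amounts to; the choice of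
  \<open>outer D\<close> makes it one in the
  plane.
\<close>

definition plane :: "diagram \<Rightarrow> bool" where
  "plane D \<longleftrightarrow>
     (\<forall>v\<in>verts D. corners_agree D v) \<and>
     (\<forall>f\<in>faces D. \<forall>g\<in>faces D.
        (f, g) \<in> (\<Union>a\<in>arcs D. {(lface D a, rface D a), (rface D a, lface D a)})\<^sup>*) \<and>
     card (verts D) + card (faces D) =
       card (arcs D) + 1 + card (arcs D // graph_connected D) \<and>
     outer D \<in> faces D"

definition link_diagram :: "diagram \<Rightarrow> bool" where
  "link_diagram D \<longleftrightarrow>
     finite (verts D) \<and> arcs_matched (verts D) \<and> two_components D \<and> plane D"


section \<open>Redrawing a diagram\<close>

fun map_vert :: "(arc \<Rightarrow> arc) \<Rightarrow> vert \<Rightarrow> vert" where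
  "map_vert g (Point a b) = Point (g a) (g b)"
| "map_vert g (Crossing k a b c d) = Crossing k (g a) (g b) (g c) (g d)"

definition renames :: "diagram \<Rightarrow> diagram \<Rightarrow> bool" where
  "renames D D' \<longleftrightarrow>
     (\<exists>g h. inj_on g (arcs D) \<and> inj_on h (faces D) \<and>
        verts D' = map_vert g ` verts D \<and> outer D' = h (outer D) \<and>
        (\<forall>a\<in>arcs D. lab D' (g a) = lab D a \<and>
           lface D' (g a) = h (lface D a) \<and> rface D' (g a) = h (rface D a)))"

text \<open>\<open>D'\<close> arises from \<open>D\<close> by a new point, which cuts the arc \<open>a\<close> of \<open>D\<close> into \<open>a\<close>
  and \<open>b\<close>.\<close>

definition subdivides :: "diagram \<Rightarrow> diagram \<Rightarrow> bool" where
  "subdivides D D' \<longleftrightarrow>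
     (\<exists>a b. a \<noteq> b \<and> Point a b \<in> verts D' \<and>
        verts D = map_vert (id(b := a)) ` (verts D' - {Point a b}) \<and>
        outer D = outer D' \<and>
        (\<forall>x\<in>arcs D. lab D x = lab D' x \<and> lface D x = lface D' x \<and> rface D x = rface D' x))"


section \<open>Generalized Reidemeister moves\<close>

fun switch :: "kind \<Rightarrow> kind" where
  "switch Virtual = Virtual"
| "switch OverL = OverR"
| "switch OverR = OverL"

text \<open>Strands with prescribed direction.  \<open>pt s a b\<close> is a strand through \<open>a\<close> and \<open>b\<close>,
  directed from \<open>a\<close> to \<open>b\<close> iff \<open>s\<close>.  In \<open>cross s t k e0 e1 e2 e3\<close> the arcs
  \<open>e0, e1, e2, e3\<close> are in counterclockwise order around a crossing, the strand through
  \<open>e0\<close> and \<open>e2\<close> is directed from \<open>e0\<close> to \<open>e2\<close> iff \<open>s\<close>, the one through \<open>e1\<close> and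
  \<open>e3\<close> from \<open>e1\<close> to \<open>e3\<close> iff \<open>t\<close>, and \<open>k = OverL\<close> means that the strand through
  \<open>e0\<close> and \<open>e2\<close> is over, \<open>k = OverR\<close> that the other one is.\<close>

fun pt :: "bool \<Rightarrow> arc \<Rightarrow> arc \<Rightarrow> vert" where
  "pt True a b = Point a b"
| "pt False a b = Point b a"

fun cross :: "bool \<Rightarrow> bool \<Rightarrow> kind \<Rightarrow> arc \<Rightarrow> arc \<Rightarrow> arc \<Rightarrow> arc \<Rightarrow> vert" where
  "cross True True k e0 e1 e2 e3 = Crossing k e0 e1 e3 e2"
| "cross True False k e0 e1 e2 e3 = Crossing (switch k) e3 e0 e2 e1"
| "cross False True k e0 e1 e2 e3 = Crossing (switch k) e1 e2 e0 e3"
| "cross False False k e0 e1 e2 e3 = Crossing k e2 e3 e1 e0"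

text \<open>The face to the left when the arc \<open>a\<close> is traversed forwards (\<open>s\<close>) or backwards.\<close>

definition side :: "diagram \<Rightarrow> bool \<Rightarrow> arc \<Rightarrow> face" where
  "side D s a = (if s then lface D a else rface D a)"

text \<open>\<open>D\<close> and \<open>D'\<close> agree outside a disc in which they look like \<open>T\<close> and \<open>T'\<close>.
  \<open>I\<close> contains the arcs of \<open>T\<close> and \<open>T'\<close> that lie inside the disc, and \<open>m\<close> maps the
  faces of \<open>D'\<close> that reach out of the disc to those of \<open>D\<close>.\<close>

definition replaces ::
    "vert set \<Rightarrow> vert set \<Rightarrow> arc set \<Rightarrow> (face \<Rightarrow> face) \<Rightarrow> diagram \<Rightarrow> diagram \<Rightarrow> bool" where
  "replaces T T' I m D D' \<longleftrightarrow>
     T \<subseteq> verts D \<and> T' \<subseteq> verts D' \<and> verts D - T = verts D' - T' \<and>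
     outer D = m (outer D') \<and>
     (\<forall>a\<in>arcs D - I. lab D a = lab D' a \<and>
        lface D a = m (lface D' a) \<and> rface D a = m (rface D' a))"

text \<open>The face \<open>f\<close> lies inside the disc of a move whose inner arcs are \<open>I\<close>.\<close>

definition inner_face :: "diagram \<Rightarrow> arc set \<Rightarrow> face \<Rightarrow> bool" where
  "inner_face D I f \<longleftrightarrow>
     f \<noteq> outer D \<and> (\<forall>a\<in>arcs D - I. lface D a \<noteq> f \<and> rface D a \<noteq> f)"

text \<open>
  RI and VRI: a strand from \<open>a\<close> to \<open>b\<close> gets a kink \<open>l\<close> on its right or on its left.

  RII and VRII: strand 1 (\<open>a\<close> below, \<open>b\<close> above) is to the left of strand 2 (\<open>c\<close> below,
  \<open>d\<close> above); it is pushed to the right across strand 2, which creates a lower crossing, an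
  upper crossing, and between them the inner arcs \<open>e\<close> of strand 1 and \<open>f\<close> of strand 2,
  which bound a bigon.  The face between the strands is cut, and \<open>merge\<close> glues the two
  parts together again.

  RIII, VRIII and SV: strands 1, 2, 3 join opposite corners of a hexagon whose corners are
  \<open>p1, p2, p3, q1, q2, q3\<close> in counterclockwise order, starting in the east.  Strand 1
  passes above (\<open>triangle_above\<close>) or below (\<open>triangle_below\<close>) the crossing of the other
  two strands; \<open>m1, m2, m3\<close> are the sides of the triangle, and \<open>k12\<close> etc. are the kinds
  of the crossings, with \<open>OverL\<close> meaning that the first named strand is over.

  The directions \<open>s, t, s1, s2, s3\<close> are arbitrary, so that all orientations are covered.
\<close>

definition merge :: "face \<Rightarrow> face \<Rightarrow> face \<Rightarrow> face" where
  "merge p q = id(q := p)"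

definition triangle_above where
  "triangle_above s1 s2 s3 k12 k13 k23 p1 p2 p3 q1 q2 q3 m1 m2 m3 =
     {cross s1 s2 k12 p1 p2 m1 m2, cross s1 s3 k13 m1 p3 q1 m3, cross s2 s3 k23 m2 m3 q2 q3}"

definition triangle_below where
  "triangle_below s1 s2 s3 k12 k13 k23 p1 p2 p3 q1 q2 q3 m1 m2 m3 =
     {cross s2 s3 k23 p2 p3 m2 m3, cross s1 s3 k13 p1 m3 m1 q3, cross s1 s2 k12 m1 m2 q1 q2}"

text \<open>In RIII the three strands lie at distinct heights.\<close>

definition RIII_kinds :: "kind \<Rightarrow> kind \<Rightarrow> kind \<Rightarrow> bool" where
  "RIII_kinds k12 k13 k23 \<longleftrightarrow>
     (\<exists>h1 h2 h3 :: nat. distinct [h1, h2, h3] \<and>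
        k12 = (if h1 > h2 then OverL else OverR) \<and>
        k13 = (if h1 > h3 then OverL else OverR) \<and>
        k23 = (if h2 > h3 then OverL else OverR))"

definition VRIII_kinds :: "kind \<Rightarrow> kind \<Rightarrow> kind \<Rightarrow> bool" where
  "VRIII_kinds k12 k13 k23 \<longleftrightarrow> k12 = Virtual \<and> k13 = Virtual \<and> k23 = Virtual"

definition SV_kinds :: "kind \<Rightarrow> kind \<Rightarrow> kind \<Rightarrow> bool" where
  "SV_kinds k12 k13 k23 \<longleftrightarrow>
     (k12 \<noteq> Virtual \<and> k13 = Virtual \<and> k23 = Virtual) \<or>
     (k12 = Virtual \<and> k13 \<noteq> Virtual \<and> k23 = Virtual) \<or>
     (k12 = Virtual \<and> k13 = Virtual \<and> k23 \<noteq> Virtual)"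

inductive virtual_move :: "diagram \<Rightarrow> diagram \<Rightarrow> bool" where
  rename: "renames D D' \<Longrightarrow> virtual_move D D'"
| subdivide: "subdivides D D' \<Longrightarrow> virtual_move D D'"
| R1_right:
    "\<lbrakk>replaces {Point a b} {Crossing k a l b l} {l} id D D'; l \<notin> {a, b};
      inner_face D' {l} (rface D' l)\<rbrakk>
     \<Longrightarrow> virtual_move D D'"
| R1_left:
    "\<lbrakk>replaces {Point a b} {Crossing k l a l b} {l} id D D'; l \<notin> {a, b};
      inner_face D' {l} (lface D' l)\<rbrakk>
     \<Longrightarrow> virtual_move D D'"
| R2:
    "\<lbrakk>replaces {pt s a b, pt t c d} {cross s t k a c e f, cross t s (switch k) f e d b} {e, f}
        (merge (side D' t c) (side D' t d)) D D';
      pt s a b \<noteq> pt t c d; e \<noteq> f; {e, f} \<inter> {a, b, c, d} = {};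
      inner_face D' {e, f} (side D' s e)\<rbrakk>
     \<Longrightarrow> virtual_move D D'"
| R3:
    "\<lbrakk>RIII_kinds k12 k13 k23 \<or> VRIII_kinds k12 k13 k23 \<or> SV_kinds k12 k13 k23;
      replaces (triangle_above s1 s2 s3 k12 k13 k23 p1 p2 p3 q1 q2 q3 m1 m2 m3)
        (triangle_below s1 s2 s3 k12 k13 k23 p1 p2 p3 q1 q2 q3 m1 m2 m3) {m1, m2, m3} id D D';
      distinct [m1, m2, m3]; {m1, m2, m3} \<inter> {p1, p2, p3, q1, q2, q3} = {};
      inner_face D {m1, m2, m3} (side D s1 m1);
      inner_face D' {m1, m2, m3} (side D' (\<not> s1) m1)\<rbrakk>
     \<Longrightarrow> virtual_move D D'"

fun switch_vert :: "vert \<Rightarrow> vert" where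
  "switch_vert (Point a b) = Point a b"
| "switch_vert (Crossing k a b c d) = Crossing (switch k) a b c d"

inductive flat_move :: "diagram \<Rightarrow> diagram \<Rightarrow> bool" where
  virtual: "virtual_move D D' \<Longrightarrow> flat_move D D'"
| crossing_change:
    "\<lbrakk>v \<in> verts D; classical v\<rbrakk>
     \<Longrightarrow> flat_move D (D\<lparr>verts := insert (switch_vert v) (verts D - {v})\<rparr>)"

definition equivalent_by :: "(diagram \<Rightarrow> diagram \<Rightarrow> bool) \<Rightarrow> (diagram \<times> diagram) set" where
  "equivalent_by move =
     {(D, D'). link_diagram D \<and> link_diagram D' \<and>
        equivclp (\<lambda>A B. link_diagram A \<and> link_diagram B \<and> move A B) D D'}"

text \<open>The equivalence relations on diagrams whose classes are the ordered oriented virtual,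
  respectively flat virtual, 2-component links.\<close>

definition virtual_equiv :: "(diagram \<times> diagram) set" where
  "virtual_equiv = equivalent_by virtual_move"

definition flat_equiv :: "(diagram \<times> diagram) set" where
  "flat_equiv = equivalent_by flat_move"

lemma equiv_equivalent_by: "equiv {D. link_diagram D} (equivalent_by move)"
  unfolding equivalent_by_def
  by (rule equivI)
     (auto simp: refl_on_def sym_def trans_def intro: equivclp_sym equivclp_trans)


section \<open>Sign, index and the odd writhes\<close>

text \<open>\<open>Ind\<close> and \<open>J\<close> depend on the vertices of a knot diagram only, and not on its
  faces.\<close>

fun sign :: "vert \<Rightarrow> int" where
  "sign (Point a b) = 0"
| "sign (Crossing k a b c d) = (case k of Virtual \<Rightarrow> 0 | OverL \<Rightarrow> 1 | OverR \<Rightarrow> -1)"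

fun labels_at :: "(arc \<Rightarrow> int) \<Rightarrow> vert \<Rightarrow> bool" where
  "labels_at n (Point a b) \<longleftrightarrow> n b = n a"
| "labels_at n (Crossing k a b c d) \<longleftrightarrow>
     (if k = Virtual then n c = n b \<and> n d = n a else n c = n b + 1 \<and> n d = n a - 1)"

definition labelling :: "vert set \<Rightarrow> (arc \<Rightarrow> int) \<Rightarrow> bool" where
  "labelling E n \<longleftrightarrow> (\<forall>v\<in>E. labels_at n v)"

text \<open>For a knot diagram the labelling exists and is unique up to an additive constant, so
  the index does not depend on the choice.\<close>

fun Ind :: "vert set \<Rightarrow> vert \<Rightarrow> int" where
  "Ind E (Point a b) = 0"
| "Ind E (Crossing k a b c d) =
     (let n = (SOME n. labelling E n) in sign (Crossing k a b c d) * (n a - n b - 1))"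

definition J :: "int \<Rightarrow> vert set \<Rightarrow> int" where
  "J n E = (\<Sum>c | c \<in> E \<and> classical c \<and> Ind E c = n. sign c)"

definition nabla_J :: "int \<Rightarrow> vert set \<Rightarrow> int" where
  "nabla_J n E = J n E - J (-n) E"


section \<open>Type-3 smoothing and span\<close>

fun reorient :: "(arc \<Rightarrow> bool) \<Rightarrow> vert \<Rightarrow> vert" where
  "reorient keep (Point a b) = pt (keep a) a b"
| "reorient keep (Crossing k a b c d) = cross (keep a) (keep b) k a b d c"

fun over_in :: "vert \<Rightarrow> arc" where
  "over_in (Crossing k a b c d) = (if k = OverL then a else b)"
| "over_in (Point a b) = a"

fun under_in :: "vert \<Rightarrow> arc" where
  "under_in (Crossing k a b c d) = (if k = OverL then b else a)"
| "under_in (Point a b) = a"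

fun joined :: "(arc \<Rightarrow> bool) \<Rightarrow> vert \<Rightarrow> vert set" where
  "joined keep (Crossing k a b c d) = {pt (keep a) a b, pt (keep a) c d}"
| "joined keep (Point a b) = {Point a b}"

text \<open>The flag \<open>keep_over\<close> is the convention: the component that keeps its orientation is
  the one passing over at \<open>c\<close> if it is true, and the one passing under if it is false.\<close>

definition smoothing :: "bool \<Rightarrow> diagram \<Rightarrow> vert \<Rightarrow> vert set" where
  "smoothing keep_over D c =
     (let kept = lab D (if keep_over then over_in c else under_in c);
          keep = (\<lambda>a. lab D a = kept)
      in reorient keep ` (verts D - {c}) \<union> joined keep c)"

definition over_set :: "diagram \<Rightarrow> vert set" where
  "over_set D =
     {c \<in> verts D. classical c \<and> lab D (over_in c) = K1 \<and> lab D (under_in c) = K2}"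

definition under_set :: "diagram \<Rightarrow> vert set" where
  "under_set D =
     {c \<in> verts D. classical c \<and> lab D (under_in c) = K1 \<and> lab D (over_in c) = K2}"

definition I_set :: "bool \<Rightarrow> int \<Rightarrow> int \<Rightarrow> diagram \<Rightarrow> vert set" where
  "I_set keep_over n k D =
     {c \<in> verts D. classical c \<and> lab D (over_in c) \<noteq> lab D (under_in c) \<and>
        nabla_J n (smoothing keep_over D c) = k}"

definition span :: "bool \<Rightarrow> int \<Rightarrow> int \<Rightarrow> diagram \<Rightarrow> int" where
  "span keep_over n k D =
     (\<Sum>c \<in> over_set D \<inter> I_set keep_over n k D. sign c)
     - (\<Sum>c \<in> under_set D \<inter> I_set keep_over n k D. sign c)"

definition fspan :: "bool \<Rightarrow> int \<Rightarrow> int \<Rightarrow> diagram \<Rightarrow> int" where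
  "fspan keep_over n k D = span keep_over n k D + span keep_over n (-k) D"

end

theory Submission
  imports Defs
begin

text \<open>
  The faces play no role.  Put \<open>\<epsilon> = 1\<close> on the arcs that keep their orientation in the
  smoothing at \<open>c\<close> and \<open>\<epsilon> = -1\<close> on the others.  Pulled back to the link diagram, the
  labelling of the knot diagram changes by \<open>- \<epsilon> b\<close> from \<open>a\<close> to \<open>d\<close> and by \<open>\<epsilon> a\<close> from
  \<open>b\<close> to \<open>c\<close> at each crossing other than the smoothed one, whatever the orientations.  Switching
  a crossing changes both its sign and its index by a sign, so that \<open>nabla_J\<close> is a sum of
  weights that do not see the over/under information.  Each move extends a labelling
  across the disc with the same total weight, also if one of its crossings is the smoothed one;
  the two crossings of RII have equal \<open>nabla_J\<close> and opposite contributions to the span.  Switching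
  the smoothed crossing exchanges the two components and hence negates \<open>\<epsilon>\<close>, the labels and
  \<open>nabla_J\<close>, which is why only \<open>fspan\<close> is a flat invariant.
\<close>


section \<open>Signed labellings at a vertex\<close>

text \<open>A crossing of index \<open>i\<close> and sign \<open>s\<close> contributes \<open>bump n (2 * s * i)\<close> to \<open>nabla_J n\<close>.
  The factor 2 allows the argument to be written symmetrically in the four labels at the crossing.\<close>

definition bump :: "int \<Rightarrow> int \<Rightarrow> int" where
  "bump n y = of_bool (y = 2 * n) - of_bool (y = - 2 * n)"

lemma bump_minus: "bump n (- y) = - bump n y"
  by (auto simp: bump_def)

lemma bump_0 [simp]: "bump n 0 = 0"
  by (auto simp: bump_def)

fun shifts :: "(arc \<Rightarrow> int) \<Rightarrow> (arc \<Rightarrow> int) \<Rightarrow> vert \<Rightarrow> bool" where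
  "shifts \<epsilon> m (Point a b) \<longleftrightarrow> m b = m a"
| "shifts \<epsilon> m (Crossing k a b c d) \<longleftrightarrow>
     (if k = Virtual then m c = m b \<and> m d = m a else m c = m b + \<epsilon> a \<and> m d = m a - \<epsilon> b)"

text \<open>If \<open>\<epsilon>\<close> is 1 and \<open>m\<close> is a labelling, the argument of
  \<open>bump\<close> is \<open>2 * (m a - m b - 1)\<close>. Sign times index is
  \<open>m a - m b - 1\<close> for both classical kinds, so \<open>OverL\<close> and
  \<open>OverR\<close> get the same weight.\<close>

fun weight :: "int \<Rightarrow> (arc \<Rightarrow> int) \<Rightarrow> (arc \<Rightarrow> int) \<Rightarrow> vert \<Rightarrow> int" where
  "weight n \<epsilon> m (Point a b) = 0"
| "weight n \<epsilon> m (Crossing k a b c d) =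
     (if k = Virtual then 0 else \<epsilon> a * \<epsilon> b * bump n ((m a + m d) - (m b + m c)))"

text \<open>This is what the two points of \<open>joined\<close> demand of a labelling.\<close>

fun joins :: "(arc \<Rightarrow> int) \<Rightarrow> vert \<Rightarrow> bool" where
  "joins m (Point a b) \<longleftrightarrow> m b = m a"
| "joins m (Crossing k a b c d) \<longleftrightarrow> m b = m a \<and> m d = m c"

abbreviation sgn_of :: "bool \<Rightarrow> int" where
  "sgn_of s \<equiv> (if s then 1 else - 1)"

section \<open>Labels and weights at crossings drawn with arbitrary directions\<close>

lemma switch_simps [simp]:
  "switch k = Virtual \<longleftrightarrow> k = Virtual" "switch k = OverL \<longleftrightarrow> k = OverR"
  "switch k = OverR \<longleftrightarrow> k = OverL" "switch (switch k) = k"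
  by (cases k; simp)+

lemma classical_cross [simp]: "classical (cross s t k e0 e1 e2 e3) \<longleftrightarrow> k \<noteq> Virtual"
  by (cases s; cases t) auto

lemma arcs_cross: "set (ins (cross s t k e0 e1 e2 e3)) \<union> set (outs (cross s t k e0 e1 e2 e3)) = {e0, e1, e2, e3}"
  by (cases s; cases t) auto

text \<open>Reversing a strand exchanges its incoming and outgoing ends, and negating
  \<open>\<epsilon>\<close> on it has the same effect on the shifts. Directions and
  \<open>\<epsilon>\<close> therefore enter only through their products, one for each
  strand.\<close>

lemma shifts_cross:
  assumes "\<epsilon> e2 = \<epsilon> e0" "\<epsilon> e3 = \<epsilon> e1"
  shows "shifts \<epsilon> m (cross s t k e0 e1 e2 e3) \<longleftrightarrow>
    (if k = Virtual then m e2 = m e0 \<and> m e3 = m e1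
     else m e2 = m e0 - sgn_of t * \<epsilon> e1 \<and> m e3 = m e1 + sgn_of s * \<epsilon> e0)"
  using assms by (cases s; cases t) auto

text \<open>If \<open>s\<close> and \<open>t\<close> differ, the two strands exchange their roles in
  the argument of \<open>bump\<close>; since \<open>bump n\<close> is odd, this gives the sign
  \<open>sgn_of s * sgn_of t\<close>.\<close>

lemma weight_cross:
  assumes "\<epsilon> e2 = \<epsilon> e0" "\<epsilon> e3 = \<epsilon> e1"
  shows "weight n \<epsilon> m (cross s t k e0 e1 e2 e3) =
    (if k = Virtual then 0
     else (sgn_of s * \<epsilon> e0) * (sgn_of t * \<epsilon> e1) * bump n ((m e0 + m e2) - (m e1 + m e3)))"
proof -
  have "bump n (m e1 + m e3 - (m e0 + m e2)) = - bump n (m e0 + m e2 - (m e1 + m e3))"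
    by (simp flip: bump_minus)
  then show ?thesis
    using assms by (cases s; cases t) (simp_all add: add.commute mult.commute)
qed

text \<open>In the cyclic order, \<open>e0\<close> and its neighbour \<open>e1\<close> are both
  incoming or both outgoing if \<open>s = t\<close>; otherwise \<open>e0\<close> is paired with its
  other neighbour \<open>e3\<close>.\<close>

lemma joins_cross:
  "joins m (cross s t k e0 e1 e2 e3) \<longleftrightarrow>
    (if s = t then m e1 = m e0 \<and> m e3 = m e2 else m e3 = m e0 \<and> m e2 = m e1)"
  by (cases s; cases t) auto

lemma sign_cross: "sign (cross s t k e0 e1 e2 e3) = sgn_of s * sgn_of t * sign (Crossing k e0 e1 e3 e2)"
  by (cases s; cases t; cases k) auto

lemma lab_over_cross:
  assumes "k \<noteq> Virtual" "l e2 = l e0" "l e3 = l e1"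
  shows "l (over_in (cross s t k e0 e1 e2 e3)) = (if k = OverL then l e0 else l e1)"
    and "l (under_in (cross s t k e0 e1 e2 e3)) = (if k = OverL then l e1 else l e0)"
  using assms by (cases s; cases t; cases k; simp)+

section \<open>Reoriented vertices, and \<open>nabla_J\<close> as a sum of weights\<close>

lemma labels_at_eq_shifts: "labels_at m v \<longleftrightarrow> shifts (\<lambda>_. 1) m v"
  by (cases v) auto

lemma labels_at_pt: "labels_at m (pt s a b) \<longleftrightarrow> m a = m b"
  by (cases s) auto

text \<open>Reversing strands leaves the labels on their arcs and only changes which ends are
  incoming. A labelling of the reoriented diagram is thus a signed labelling of the link diagram
  with the same values.\<close>

lemma labels_at_reorient: "labels_at m (reorient keep v) \<longleftrightarrow> shifts (\<lambda>x. sgn_of (keep x)) m v"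
  by (cases v) (auto simp: labels_at_eq_shifts shifts_cross labels_at_pt[unfolded labels_at_eq_shifts])

lemma weight_reorient: "weight n (\<lambda>_. 1) m (reorient keep v) = weight n (\<lambda>x. sgn_of (keep x)) m v"
proof (cases v)
  case (Point a b)
  then show ?thesis by (cases "keep a") auto
next
  case (Crossing k a b c d)
  then show ?thesis by (simp add: weight_cross add.commute)
qed

text \<open>The index is defined by a labelling chosen with \<open>SOME\<close>. The existence of
  \<open>m\<close> makes this choice a labelling; it stays in the formula until
  \<open>nabla_J_smoothing\<close> replaces it by an arbitrary one.\<close>

lemma nabla_J_eq_weight:
  assumes "finite E" "labelling E m"
  shows "nabla_J n E = (\<Sum>v\<in>E. weight n (\<lambda>_. 1) (SOME m. labelling E m) v)"
proof -
  define N where "N = (SOME m. labelling E m)"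
  have "labelling E N"
    unfolding N_def by (rule someI[of "labelling E", OF assms(2)])
  then have N: "labels_at N v" if "v \<in> E" for v
    using that by (simp add: labelling_def)
  have J: "J i E = (\<Sum>v\<in>E. if classical v \<and> Ind E v = i then sign v else 0)" for i
    unfolding J_def using assms(1) by (simp add: sum.inter_filter)
  have *: "(if classical v \<and> Ind E v = n then sign v else 0) - (if classical v \<and> Ind E v = - n then sign v else 0)
    = weight n (\<lambda>_. 1) N v" if "v \<in> E" for v
  proof (cases v)
    case (Crossing k a b c d)
    have I: "Ind E v = sign v * (N a - N b - 1)"
      unfolding Crossing N_def by (simp add: Let_def)
    \<comment> \<open>The index is \<open>w\<close> for \<open>OverL\<close> and \<open>- w\<close>
      for \<open>OverR\<close>, so sign times index is \<open>w\<close> in both cases.\<close>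
    define w where "w = N a - N b - 1"
    have "bump n (2 * w) = of_bool (w = n) - of_bool (w = - n)"
      by (auto simp: bump_def)
    moreover have "k \<noteq> Virtual \<Longrightarrow> N a + N d - (N b + N c) = 2 * w"
      using N[OF that] unfolding Crossing w_def by simp
    ultimately show ?thesis
      unfolding I w_def[symmetric] unfolding Crossing by (cases k) auto
  qed simp
  show ?thesis
    unfolding nabla_J_def J sum_subtractf[symmetric] N_def[symmetric] by (rule sum.cong[OF refl *])
qed

lemma weight_shift_const: "(\<And>x. x \<in> set (ins v) \<union> set (outs v) \<Longrightarrow> m x = m' x + h) \<Longrightarrow> weight n \<epsilon> m v = weight n \<epsilon> m' v"
  by (cases v) (auto simp: algebra_simps)

section \<open>Labellings of a diagram cut at a crossing\<close>

abbreviation ends :: "vert \<Rightarrow> arc set" where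
  "ends v \<equiv> set (ins v) \<union> set (outs v)"

definition mixed :: "diagram \<Rightarrow> vert \<Rightarrow> bool" where
  "mixed D c \<longleftrightarrow> classical c \<and> lab D (over_in c) \<noteq> lab D (under_in c)"

definition kept_at :: "bool \<Rightarrow> diagram \<Rightarrow> vert \<Rightarrow> component" where
  "kept_at keep_over D c = lab D (if keep_over then over_in c else under_in c)"

definition eps :: "diagram \<Rightarrow> component \<Rightarrow> arc \<Rightarrow> int" where
  "eps D \<kappa> x = (if lab D x = \<kappa> then 1 else - 1)"

text \<open>A labelling of the smoothed knot, written on the arcs of the link diagram.\<close>

definition cut_labelling :: "vert set \<Rightarrow> (arc \<Rightarrow> int) \<Rightarrow> vert \<Rightarrow> (arc \<Rightarrow> int) \<Rightarrow> bool" where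
  "cut_labelling V \<epsilon> c m \<longleftrightarrow> (\<forall>v\<in>V - {c}. shifts \<epsilon> m v) \<and> joins m c"

section \<open>Arcs, strands and component labels at a vertex\<close>

lemma mixed_Crossing:
  "mixed D (Crossing k a b c d) \<longleftrightarrow> k \<noteq> Virtual \<and> lab D a \<noteq> lab D b"
  by (cases k) (auto simp: mixed_def)

lemma mixedE:
  assumes "mixed D v"
  obtains k a b c d where "v = Crossing k a b c d" "k \<noteq> Virtual" "lab D a \<noteq> lab D b"
  using assms by (cases v) (auto simp: mixed_Crossing, auto simp: mixed_def)

lemma passes_ends: "(x, y) \<in> passes v \<Longrightarrow> x \<in> set (ins v) \<and> y \<in> set (outs v)"
  by (cases v) auto

lemma ins_passes: "x \<in> set (ins v) \<Longrightarrow> \<exists>y. (x, y) \<in> passes v"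
  by (cases v) auto

lemma ins_unique:
  assumes "arcs_matched V" "v \<in> V" "w \<in> V" "x \<in> set (ins v)" "x \<in> set (ins w)"
  shows "v = w"
proof -
  have "x \<in> arcs_of V" using assms(2,4) by (auto simp: arcs_of_def)
  then show ?thesis using assms unfolding arcs_matched_def by blast
qed

lemma outs_unique:
  assumes "arcs_matched V" "v \<in> V" "w \<in> V" "x \<in> set (outs v)" "x \<in> set (outs w)"
  shows "v = w"
proof -
  have "x \<in> arcs_of V" using assms(2,4) by (auto simp: arcs_of_def)
  then show ?thesis using assms unfolding arcs_matched_def by blast
qed

lemma distinct_ends:
  assumes "arcs_matched V" "v \<in> V"
  shows "distinct (ins v)" "distinct (outs v)"
  using assms unfolding arcs_matched_def by auto

lemma arcs_of_ins: "arcs_matched V \<Longrightarrow> arcs_of V = (\<Union>v\<in>V. set (ins v))"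
  unfolding arcs_matched_def arcs_of_def by blast

lemma lab_passes:
  assumes "link_diagram D" "v \<in> verts D" "(x, y) \<in> passes v"
  shows "lab D y = lab D x"
proof -
  have "x \<in> arcs D" "y \<in> arcs D"
    using assms(2) passes_ends[OF assms(3)] by (auto simp: arcs_of_def)
  moreover have "(x, y) \<in> (\<Union>v\<in>verts D. passes v)\<^sup>*"
    using assms(2,3) by blast
  ultimately have "lab D x = lab D y"
    using assms(1) by (simp add: link_diagram_def two_components_def)
  then show ?thesis ..
qed

lemma lab_Crossing:
  assumes "link_diagram D" "Crossing k a b c d \<in> verts D"
  shows "lab D d = lab D a" "lab D c = lab D b"
  using lab_passes[OF assms] by auto

text \<open>\<open>C\<close> is a cycle of \<open>s\<close>, cut open between its last element
  \<open>a\<close> and its first element \<open>d\<close>. The prescribed increments are summed up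
  along the path from \<open>d\<close>; no closing condition arises, since the step from
  \<open>a\<close> back to \<open>d\<close> is left out.\<close>

lemma potential_on_cut_cycle:
  fixes \<Delta> :: "'a \<Rightarrow> int"
  assumes C: "\<And>x. x \<in> C \<longleftrightarrow> (\<exists>i. x = (s ^^ i) d)" and a: "a \<in> C" "s a = d"
  shows "\<exists>m. m d = 0 \<and> m a = (\<Sum>x\<in>C - {a}. \<Delta> x) \<and> (\<forall>x\<in>C - {a}. m (s x) = m x + \<Delta> x)"
proof -
  \<comment> \<open>\<open>N\<close> is the first time at which the walk from \<open>d\<close>
    reaches \<open>a\<close>, so the cycle has \<open>N + 1\<close> elements.\<close>
  define N where "N = (LEAST i. (s ^^ i) d = a)"
  define p where "p i = (s ^^ i) d" for i
  have "\<exists>i. (s ^^ i) d = a" using a(1) C by auto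
  then have pN: "p N = a" unfolding N_def p_def by (rule LeastI_ex)
  have less: "p i \<noteq> a" if "i < N" for i
    using that not_less_Least unfolding N_def p_def by blast
  have pS: "p (Suc i) = s (p i)" for i by (simp add: p_def)
  have padd: "p (i + j) = (s ^^ i) (p j)" for i j by (simp add: p_def funpow_add)
  \<comment> \<open>If the walk met an element twice up to time \<open>N\<close>, the remaining
    steps taken from the earlier visit would reach \<open>a\<close> too soon.\<close>
  have inj: "inj_on p {..N}"
  proof (rule linorder_inj_onI)
    fix i j assume ij: "i < j" "j \<in> {..N}"
    show "p i \<noteq> p j"
    proof
      assume "p i = p j"
      then have "p ((N - j) + i) = p ((N - j) + j)" by (simp only: padd)
      then have "p ((N - j) + i) = a" using ij pN by simp
      then show False using less ij by simp
    qed
  qed auto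
  have "p i \<in> p ` {..N}" for i
  proof (induction i)
    case (Suc i)
    then obtain j where j: "j \<le> N" "p i = p j" by auto
    show ?case
    proof (cases "j = N")
      case True
      then have "p (Suc i) = p 0" using j pN a pS by (simp add: p_def)
      then show ?thesis by auto
    next
      case False
      then have "p (Suc i) = p (Suc j)" "Suc j \<le> N" using j pS by auto
      then show ?thesis by (metis atMost_iff imageI)
    qed
  qed auto
  then have img: "C = p ` {..N}"
    using C by (auto simp: p_def)
  define idx where "idx = the_inv_into {..N} p"
  have idx: "idx (p i) = i" if "i \<le> N" for i
    unfolding idx_def using inj that by (simp add: the_inv_into_f_f)
  define m where "m x = (\<Sum>i<idx x. \<Delta> (p i))" for x
  have CN: "C - {a} = p ` {..<N}"
    unfolding img pN[symmetric] using inj by (auto simp: inj_on_def less_le)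
  have "m d = 0"
    using idx[of 0] by (simp add: m_def p_def)
  moreover have "m a = (\<Sum>x\<in>C - {a}. \<Delta> x)"
    unfolding CN using idx[of N] inj pN
    by (subst sum.reindex) (auto intro: inj_on_subset simp: m_def)
  moreover have "m (s x) = m x + \<Delta> x" if x: "x \<in> C - {a}" for x
  proof -
    obtain i where i: "i < N" "x = p i" using x unfolding CN by auto
    then show ?thesis using idx[of i] idx[of "Suc i"] by (simp add: m_def pS)
  qed
  ultimately show ?thesis by blast
qed

text \<open>The change of the label along the strand that enters at \<open>x\<close>; the last
  branch is the value at \<open>x = b\<close>.\<close>

fun increment :: "(arc \<Rightarrow> int) \<Rightarrow> vert \<Rightarrow> arc \<Rightarrow> int" where
  "increment \<epsilon> (Point a b) x = 0"
| "increment \<epsilon> (Crossing k a b c d) x = (if k = Virtual then 0 else if x = a then - \<epsilon> b else \<epsilon> a)"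

lemma shifts_increment:
  assumes "distinct (ins v)"
  shows "shifts \<epsilon> m v \<longleftrightarrow> (\<forall>x y. (x, y) \<in> passes v \<longrightarrow> m y = m x + increment \<epsilon> v x)"
  using assms by (cases v) auto

text \<open>If both strands belong to one component, its two increments cancel. If they belong to
  different components, the values of \<open>\<epsilon>\<close> are opposite, so the increments
  \<open>- \<epsilon> b\<close> and \<open>\<epsilon> a\<close> are equal. This is where reversing
  one of the two components matters.\<close>

lemma increment_balance:
  assumes "link_diagram D" "v \<in> verts D"
  shows "(\<Sum>x | x \<in> set (ins v) \<and> lab D x = K1. increment (eps D \<kappa>) v x) =
         (\<Sum>x | x \<in> set (ins v) \<and> lab D x = K2. increment (eps D \<kappa>) v x)"
proof (cases v)
  case (Crossing k a b c d)
  have ab: "a \<noteq> b"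
    using distinct_ends(1)[of "verts D" v] assms Crossing by (auto simp: link_diagram_def)
  have set: "{x. x \<in> set (ins v) \<and> lab D x = K} =
     (if lab D a = K then {a} else {}) \<union> (if lab D b = K then {b} else {})" for K
    using Crossing by auto
  show ?thesis
    unfolding set unfolding Crossing using ab
    by (cases "lab D a"; cases "lab D b"; cases \<kappa>) (auto simp: eps_def)
next
  case (Point a b)
  then show ?thesis by simp
qed

text \<open>Both components are cut at \<open>c\<close>, and each labelling starts with 0 at the
  outgoing end. By \<open>increment_balance\<close>, summed over the other vertices, both arrive at
  their incoming ends with the same value, as \<open>joins\<close> demands.\<close>

lemma exists_cut_labelling:
  assumes D: "link_diagram D" and c: "c \<in> verts D" "mixed D c"
  shows "\<exists>m. cut_labelling (verts D) (eps D \<kappa>) c m"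
proof -
  define V where "V = verts D"
  define P where "P = (\<Union>v\<in>V. passes v)"
  have M: "arcs_matched V" and fin: "finite V" and two: "two_components D"
    using D by (auto simp: link_diagram_def V_def)
  obtain k a b e d where ce: "c = Crossing k a b e d" "k \<noteq> Virtual" "lab D a \<noteq> lab D b"
    using c(2) by (rule mixedE)
  have arcs_abed: "a \<in> arcs D" "b \<in> arcs D" "e \<in> arcs D" "d \<in> arcs D"
    using c(1) unfolding ce arcs_of_def by force+
  have labs: "lab D d = lab D a" "lab D e = lab D b"
    using lab_Crossing[OF D] c ce by auto
  have uniq: "y = z" if xyz: "(x, y) \<in> P" "(x, z) \<in> P" for x y z
  proof -
    obtain v w where v: "v \<in> V" "(x, y) \<in> passes v" and w: "w \<in> V" "(x, z) \<in> passes w"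
      using xyz unfolding P_def by blast
    have "v = w"
      using ins_unique[OF M v(1) w(1)] passes_ends[OF v(2)] passes_ends[OF w(2)] by auto
    then show ?thesis
      using v w distinct_ends[OF M v(1)] by (cases v) auto
  qed
  \<comment> \<open>\<open>s x\<close> is the arc that follows \<open>x\<close> on its strand; the
    orbits of \<open>s\<close> are the components.\<close>
  define s where "s x = (SOME y. (x, y) \<in> P)" for x
  have sP: "s x = y" if "(x, y) \<in> P" for x y
    unfolding s_def using that uniq by (metis someI)
  have Ps: "(x, s x) \<in> P" if x: "x \<in> arcs D" for x
  proof -
    obtain v where "v \<in> V" "x \<in> set (ins v)"
      using x arcs_of_ins[OF M] by (auto simp: V_def)
    then have "\<exists>y. (x, y) \<in> P"
      using ins_passes unfolding P_def by blast
    then show ?thesis unfolding s_def by (rule someI_ex)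
  qed
  have P_arcs: "x \<in> arcs D \<and> y \<in> arcs D" if "(x, y) \<in> P" for x y
    using that passes_ends unfolding P_def V_def arcs_of_def by blast
  define C where "C K = {x \<in> arcs D. lab D x = K}" for K
  have orbit: "x \<in> C (lab D y) \<longleftrightarrow> (\<exists>i. x = (s ^^ i) y)" if y: "y \<in> arcs D" for x y
  proof -
    have it: "(y, (s ^^ i) y) \<in> P\<^sup>* \<and> (s ^^ i) y \<in> arcs D" for i
    proof (induction i)
      case (Suc i)
      then show ?case using Ps P_arcs by (auto intro: rtrancl_into_rtrancl)
    qed (use y in auto)
    have "\<exists>i. x = (s ^^ i) y" if "(y, x) \<in> P\<^sup>*" using that
    proof (induction rule: rtrancl_induct)
      case base
      show ?case by (rule exI[of _ 0]) simp
    next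
      case (step u v)
      then obtain i where "u = (s ^^ i) y" by auto
      then have "v = (s ^^ Suc i) y" using sP step by auto
      then show ?case ..
    qed
    then have "(\<exists>i. x = (s ^^ i) y) \<longleftrightarrow> x \<in> arcs D \<and> (y, x) \<in> P\<^sup>*"
      using it P_arcs by blast
    moreover have "(y, x) \<in> P\<^sup>* \<longleftrightarrow> lab D y = lab D x" if "x \<in> arcs D"
      using two y that unfolding two_components_def P_def V_def by auto
    ultimately show ?thesis unfolding C_def by auto
  qed
  define vin where "vin x = (SOME v. v \<in> V \<and> x \<in> set (ins v))" for x
  have vin: "vin x = v" if "v \<in> V" "x \<in> set (ins v)" for v x
  proof -
    have "vin x \<in> V \<and> x \<in> set (ins (vin x))"
      unfolding vin_def by (rule someI[of _ v]) (simp add: that)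
    then show ?thesis using ins_unique[OF M _ that(1) _ that(2)] by blast
  qed
  define \<Delta> where "\<Delta> x = increment (eps D \<kappa>) (vin x) x" for x
  \<comment> \<open>\<open>z\<close> is the arc by which component \<open>K\<close> enters
    \<open>c\<close>. Leaving it out removes exactly the vertex \<open>c\<close> when the sum over
    arcs is regrouped by the vertices that they enter.\<close>
  have sum_\<Delta>: "(\<Sum>x\<in>C K - {z}. \<Delta> x) =
      (\<Sum>v\<in>V - {c}. \<Sum>x | x \<in> set (ins v) \<and> lab D x = K. increment (eps D \<kappa>) v x)"
    if z: "z = (if lab D a = K then a else b)" for K z
  proof -
    have zK: "lab D x = K \<longleftrightarrow> x = z" if "x \<in> set (ins c)" for x
      using that ce z by (cases K; cases "lab D a"; cases "lab D b") auto
    have set: "C K - {z} = (\<Union>v\<in>V - {c}. {x. x \<in> set (ins v) \<and> lab D x = K})"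
    proof -
      have zc: "z \<in> set (ins c)" using z ce by auto
      have arcsD: "x \<in> arcs D \<longleftrightarrow> (\<exists>v\<in>V. x \<in> set (ins v))" for x
        using arcs_of_ins[OF M] by (simp add: V_def)
      have vc: "v \<noteq> c \<longleftrightarrow> x \<noteq> z" if v: "v \<in> V" "x \<in> set (ins v)" "lab D x = K" for v x
      proof
        assume "v \<noteq> c"
        moreover have "v = c" if "x = z"
          using ins_unique[OF M v(1) c(1)[folded V_def] v(2)] zc that by simp
        ultimately show "x \<noteq> z" by blast
      next
        assume "x \<noteq> z"
        then show "v \<noteq> c" using zK[of x] v by blast
      qed
      show ?thesis
        unfolding C_def set_eq_iff using vc by (simp add: arcsD) blast
    qed
    have "(\<Sum>x\<in>C K - {z}. \<Delta> x) =
        (\<Sum>v\<in>V - {c}. \<Sum>x | x \<in> set (ins v) \<and> lab D x = K. \<Delta> x)"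
      unfolding set
    proof (intro sum.UNION_disjoint ballI impI)
      fix v w assume "v \<in> V - {c}" "w \<in> V - {c}" "v \<noteq> w"
      then have "set (ins v) \<inter> set (ins w) = {}"
        using ins_unique[OF M, of v w] by blast
      then show "{x. x \<in> set (ins v) \<and> lab D x = K} \<inter> {x. x \<in> set (ins w) \<and> lab D x = K} = {}"
        by blast
    qed (use fin in simp_all)
    also have "\<dots> = (\<Sum>v\<in>V - {c}. \<Sum>x | x \<in> set (ins v) \<and> lab D x = K. increment (eps D \<kappa>) v x)"
    proof (intro sum.cong refl)
      fix v x assume "v \<in> V - {c}" "x \<in> {x. x \<in> set (ins v) \<and> lab D x = K}"
      then have "vin x = v" by (intro vin) auto
      then show "\<Delta> x = increment (eps D \<kappa>) v x" by (simp add: \<Delta>_def)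
    qed
    finally show ?thesis .
  qed
  have sums: "(\<Sum>x\<in>C (lab D a) - {a}. \<Delta> x) = (\<Sum>x\<in>C (lab D b) - {b}. \<Delta> x)"
  proof -
    have "(\<Sum>x\<in>C (lab D a) - {a}. \<Delta> x) =
      (\<Sum>v\<in>V - {c}. \<Sum>x | x \<in> set (ins v) \<and> lab D x = lab D a. increment (eps D \<kappa>) v x)"
      by (rule sum_\<Delta>) simp
    also have "\<dots> = (\<Sum>v\<in>V - {c}. \<Sum>x | x \<in> set (ins v) \<and> lab D x = lab D b. increment (eps D \<kappa>) v x)"
    proof (rule sum.cong[OF refl])
      fix v assume "v \<in> V - {c}"
      then have "v \<in> verts D" by (simp add: V_def)
      from increment_balance[OF D this, of \<kappa>]
      show "(\<Sum>x | x \<in> set (ins v) \<and> lab D x = lab D a. increment (eps D \<kappa>) v x) =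
          (\<Sum>x | x \<in> set (ins v) \<and> lab D x = lab D b. increment (eps D \<kappa>) v x)"
        using ce(3) by (cases "lab D a"; cases "lab D b") auto
    qed
    also have "\<dots> = (\<Sum>x\<in>C (lab D b) - {b}. \<Delta> x)"
      by (rule sum_\<Delta>[symmetric]) (use ce(3) in simp)
    finally show ?thesis .
  qed
  have "s a = d" "s b = e"
    by (rule sP; use c(1) ce in \<open>force simp: P_def V_def\<close>)+
  have "\<exists>m. m d = 0 \<and> m a = (\<Sum>x\<in>C (lab D a) - {a}. \<Delta> x) \<and>
      (\<forall>x\<in>C (lab D a) - {a}. m (s x) = m x + \<Delta> x)"
  proof (rule potential_on_cut_cycle)
    show "x \<in> C (lab D a) \<longleftrightarrow> (\<exists>i. x = (s ^^ i) d)" for x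
      using orbit[OF arcs_abed(4), of x] by (simp only: labs)
    show "a \<in> C (lab D a)" using arcs_abed by (simp add: C_def)
  qed fact
  then obtain m1 where m1: "m1 d = 0" "m1 a = (\<Sum>x\<in>C (lab D a) - {a}. \<Delta> x)"
      "\<And>x. x \<in> C (lab D a) - {a} \<Longrightarrow> m1 (s x) = m1 x + \<Delta> x"
    by blast
  have "\<exists>m. m e = 0 \<and> m b = (\<Sum>x\<in>C (lab D b) - {b}. \<Delta> x) \<and>
      (\<forall>x\<in>C (lab D b) - {b}. m (s x) = m x + \<Delta> x)"
  proof (rule potential_on_cut_cycle)
    show "x \<in> C (lab D b) \<longleftrightarrow> (\<exists>i. x = (s ^^ i) e)" for x
      using orbit[OF arcs_abed(3), of x] by (simp only: labs)
    show "b \<in> C (lab D b)" using arcs_abed by (simp add: C_def)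
  qed fact
  then obtain m2 where m2: "m2 e = 0" "m2 b = (\<Sum>x\<in>C (lab D b) - {b}. \<Delta> x)"
      "\<And>x. x \<in> C (lab D b) - {b} \<Longrightarrow> m2 (s x) = m2 x + \<Delta> x"
    by blast
  \<comment> \<open>The potentials of the two components are glued according to the component
    label.\<close>
  define m where "m x = (if lab D x = lab D a then m1 x else m2 x)" for x
  have "joins m c"
    unfolding ce using m1 m2 sums labs ce(3) by (auto simp: m_def)
  moreover have "shifts (eps D \<kappa>) m v" if v: "v \<in> V - {c}" for v
    unfolding shifts_increment[OF distinct_ends(1)[OF M DiffD1[OF v]]]
  proof (intro allI impI)
    fix x y assume xy: "(x, y) \<in> passes v"
    have x: "x \<in> set (ins v)" using passes_ends[OF xy] by simp
    have xyP: "(x, y) \<in> P" using v xy by (auto simp: P_def)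
    have arcs: "x \<in> arcs D" using P_arcs[OF xyP] by simp
    have ly: "lab D y = lab D x" using lab_passes[OF D _ xy] v by (auto simp: V_def)
    have ne: "x \<noteq> a" "x \<noteq> b"
      using ins_unique[OF M _ _ x] v c ce by (force simp: V_def)+
    have "\<Delta> x = increment (eps D \<kappa>) v x"
      using vin[of v x] v x by (simp add: \<Delta>_def)
    moreover have "x \<in> C (lab D a) - {a} \<or> x \<in> C (lab D b) - {b} \<and> lab D x \<noteq> lab D a"
      using arcs ne ce(3) by (cases "lab D x"; cases "lab D a"; cases "lab D b") (auto simp: C_def)
    ultimately show "m y = m x + increment (eps D \<kappa>) v x"
      using m1(3)[of x] m2(3)[of x] sP[OF xyP] ly by (auto simp: m_def C_def)
  qed
  ultimately show ?thesis
    unfolding cut_labelling_def V_def[symmetric] by blast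
qed

section \<open>Smoothings in terms of cut labellings\<close>

lemma finite_smoothing: "finite (verts D) \<Longrightarrow> finite (smoothing ko D c)"
  by (cases c) (auto simp: smoothing_def Let_def)

lemma labelling_smoothing:
  assumes "mixed D c"
  shows "labelling (smoothing ko D c) m \<longleftrightarrow> cut_labelling (verts D) (eps D (kept_at ko D c)) c m"
proof -
  obtain k a b e d where c: "c = Crossing k a b e d" using assms by (rule mixedE)
  have eps: "(\<lambda>x. sgn_of (lab D x = \<kappa>)) = eps D \<kappa>" for \<kappa> by (auto simp: eps_def)
  have "(\<forall>v\<in>joined keep c. labels_at m v) \<longleftrightarrow> joins m c" for keep
    unfolding c by (auto simp: labels_at_pt)
  then show ?thesis
    unfolding labelling_def cut_labelling_def smoothing_def Let_def kept_at_def
    by (simp add: ball_Un labels_at_reorient eps)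
qed

text \<open>The incoming arcs of a vertex can be recovered after reorienting: the kept ones are
  still incoming, the others have become outgoing. They determine the vertex. This turns sums over
  the smoothed diagram, a set of images, into sums over the link diagram.\<close>

lemma reorient_inj:
  assumes D: "link_diagram D"
  shows "inj_on (reorient (\<lambda>x. lab D x = \<kappa>)) (verts D)"
proof (rule inj_onI)
  fix v w assume vw: "v \<in> verts D" "w \<in> verts D"
    and eq: "reorient (\<lambda>x. lab D x = \<kappa>) v = reorient (\<lambda>x. lab D x = \<kappa>) w"
  have M: "arcs_matched (verts D)" using D by (simp add: link_diagram_def)
  define f where "f = reorient (\<lambda>x. lab D x = \<kappa>)"
  have kept: "{x \<in> set (ins (f u)). lab D x = \<kappa>} = {x \<in> set (ins u). lab D x = \<kappa>} \<and>
      {x \<in> set (outs (f u)). lab D x \<noteq> \<kappa>} = {x \<in> set (ins u). lab D x \<noteq> \<kappa>}"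
    if "u \<in> verts D" for u
  proof (cases u)
    case (Point a b)
    then show ?thesis
      using lab_passes[OF D that, of a b] by (cases "lab D a = \<kappa>") (auto simp: f_def)
  next
    case (Crossing k a b c d)
    then show ?thesis
      using lab_Crossing[OF D, of k a b c d] that
      by (cases "lab D a = \<kappa>"; cases "lab D b = \<kappa>") (auto simp: f_def)
  qed
  have "{x \<in> set (ins v). lab D x = \<kappa>} = {x \<in> set (ins w). lab D x = \<kappa>}"
    "{x \<in> set (ins v). lab D x \<noteq> \<kappa>} = {x \<in> set (ins w). lab D x \<noteq> \<kappa>}"
    using kept[OF vw(1)] kept[OF vw(2)] eq by (simp_all add: f_def)
  then have "set (ins v) = set (ins w)"
    by (auto simp: set_eq_iff)
  moreover obtain x where "x \<in> set (ins v)" by (cases v) auto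
  ultimately show "v = w" using ins_unique[OF M vw] by auto
qed

text \<open>The chosen labelling and \<open>m\<close> differ by a constant: their difference does
  not change along strands away from \<open>c\<close>, and the joins at \<open>c\<close> tie the two
  components together. Weights depend only on differences of labels.\<close>

lemma nabla_J_smoothing:
  assumes D: "link_diagram D" and c: "c \<in> verts D" "mixed D c"
    and m: "cut_labelling (verts D) (eps D (kept_at ko D c)) c m"
  shows "nabla_J n (smoothing ko D c) =
    (\<Sum>v\<in>verts D - {c}. weight n (eps D (kept_at ko D c)) m v)"
proof -
  define \<kappa> where "\<kappa> = kept_at ko D c"
  define E where "E = smoothing ko D c"
  define N where "N = (SOME m. labelling E m)"
  have fin: "finite (verts D)" and M: "arcs_matched (verts D)" and two: "two_components D"
    using D by (auto simp: link_diagram_def)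
  have mE: "labelling E m" unfolding E_def using labelling_smoothing[OF c(2)] m by simp
  have "labelling E N" unfolding N_def by (rule someI[of "labelling E", OF mE])
  then have N: "cut_labelling (verts D) (eps D \<kappa>) c N"
    unfolding E_def using labelling_smoothing[OF c(2)] by (simp add: \<kappa>_def)
  obtain k a b e d where ce: "c = Crossing k a b e d" "k \<noteq> Virtual" "lab D a \<noteq> lab D b"
    using c(2) by (rule mixedE)
  have labs: "lab D d = lab D a" "lab D e = lab D b"
    using lab_Crossing[OF D] c ce by auto
  have arcs_abed: "a \<in> arcs D" "b \<in> arcs D" "e \<in> arcs D" "d \<in> arcs D"
    using c(1) unfolding ce arcs_of_def by force+
  define h where "h x = N x - m x" for x
  have h_pass: "h y = h x" if "v \<in> verts D - {c}" "(x, y) \<in> passes v" for v x y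
  proof -
    have "shifts (eps D \<kappa>) N v" "shifts (eps D \<kappa>) m v"
      using N m that by (auto simp: cut_labelling_def \<kappa>_def)
    then show ?thesis
      unfolding shifts_increment[OF distinct_ends(1)[OF M DiffD1[OF that(1)]]]
      using that(2) by (auto simp: h_def)
  qed
  \<comment> \<open>The walk starts at an outgoing end of \<open>c\<close>. Its component passes
    through \<open>c\<close> only once, so a walk that passes \<open>c\<close> is back at its
    start.\<close>
  have reach: "h y = h x" if xy: "(x, y) \<in> (\<Union>v\<in>verts D. passes v)\<^sup>*" and "x = e \<or> x = d" for x y
    using xy
  proof (induction rule: rtrancl_induct)
    case (step u y)
    then obtain v where v: "v \<in> verts D" "(u, y) \<in> passes v" by auto
    have arcs: "x \<in> arcs D" "u \<in> arcs D" "y \<in> arcs D"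
      using arcs_abed \<open>x = e \<or> x = d\<close> v passes_ends[OF v(2)] by (auto simp: arcs_of_def)
    have "lab D x = lab D u"
      using two arcs step(1) by (auto simp: two_components_def)
    show ?case
    proof (cases "v = c")
      case True
      then have "u = a \<and> y = d \<or> u = b \<and> y = e" using v ce by auto
      then have "y = x" using \<open>x = e \<or> x = d\<close> \<open>lab D x = lab D u\<close> labs ce(3) by auto
      then show ?thesis by simp
    next
      case False
      then show ?thesis using h_pass v step.IH by auto
    qed
  qed simp
  have "h e = h d"
    using N m unfolding cut_labelling_def ce by (auto simp: h_def)
  have const: "h y = h d" if "y \<in> arcs D" for y
  proof -
    have "lab D y = lab D d \<or> lab D y = lab D e"
      using labs ce(3) by (cases "lab D y"; cases "lab D a"; cases "lab D b") auto
    then have "(d, y) \<in> (\<Union>v\<in>verts D. passes v)\<^sup>* \<or> (e, y) \<in> (\<Union>v\<in>verts D. passes v)\<^sup>*"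
      using two arcs_abed that unfolding two_components_def by metis
    then show ?thesis using reach \<open>h e = h d\<close> by metis
  qed
  have "nabla_J n E = (\<Sum>v\<in>E. weight n (\<lambda>_. 1) N v)"
    unfolding N_def by (rule nabla_J_eq_weight[OF _ mE]) (simp add: E_def finite_smoothing fin)
  also have "\<dots> = (\<Sum>v\<in>reorient (\<lambda>x. lab D x = \<kappa>) ` (verts D - {c}). weight n (\<lambda>_. 1) N v)"
  \<comment> \<open>The points that replace \<open>c\<close> have weight 0.\<close>
  proof (rule sum.mono_neutral_right)
    show "finite E" by (simp add: E_def finite_smoothing fin)
    show "reorient (\<lambda>x. lab D x = \<kappa>) ` (verts D - {c}) \<subseteq> E"
      by (auto simp: E_def smoothing_def Let_def \<kappa>_def kept_at_def)
    have pt: "weight n \<epsilon> l (pt s x y) = 0" for \<epsilon> l s x y by (cases s) auto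
    have "weight n (\<lambda>_. 1) N v = 0" if "v \<in> joined keep c" for v keep
      using that unfolding ce by (auto simp: pt)
    then show "\<forall>v\<in>E - reorient (\<lambda>x. lab D x = \<kappa>) ` (verts D - {c}). weight n (\<lambda>_. 1) N v = 0"
      by (auto simp: E_def smoothing_def Let_def \<kappa>_def kept_at_def)
  qed
  also have "\<dots> = (\<Sum>v\<in>verts D - {c}. weight n (\<lambda>_. 1) N (reorient (\<lambda>x. lab D x = \<kappa>) v))"
    using reorient_inj[OF D] by (subst sum.reindex) (auto intro: inj_on_subset)
  also have "\<dots> = (\<Sum>v\<in>verts D - {c}. weight n (eps D \<kappa>) N v)"
    by (simp add: weight_reorient eps_def[abs_def])
  also have "\<dots> = (\<Sum>v\<in>verts D - {c}. weight n (eps D \<kappa>) m v)"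
  proof (rule sum.cong[OF refl])
    fix v assume "v \<in> verts D - {c}"
    then have "x \<in> arcs D" if "x \<in> ends v" for x using that by (auto simp: arcs_of_def)
    then have "N x = m x + h d" if "x \<in> ends v" for x
      using const that unfolding h_def by (metis diff_add_cancel add.commute)
    then show "weight n (eps D \<kappa>) N v = weight n (eps D \<kappa>) m v"
      by (rule weight_shift_const)
  qed
  finally show ?thesis unfolding E_def \<kappa>_def .
qed

section \<open>Local replacement\<close>

lemma shifts_cong:
  assumes "\<And>x. x \<in> ends v \<Longrightarrow> m x = m' x" "\<And>x. x \<in> ends v \<Longrightarrow> \<epsilon> x = \<epsilon>' x"
  shows "shifts \<epsilon> m v \<longleftrightarrow> shifts \<epsilon>' m' v"
  using assms by (cases v) auto

lemma weight_cong:
  assumes "\<And>x. x \<in> ends v \<Longrightarrow> m x = m' x" "\<And>x. x \<in> ends v \<Longrightarrow> \<epsilon> x = \<epsilon>' x"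
  shows "weight n \<epsilon> m v = weight n \<epsilon>' m' v"
  using assms by (cases v) auto

lemma joins_cong:
  assumes "\<And>x. x \<in> ends v \<Longrightarrow> m x = m' x"
  shows "joins m v \<longleftrightarrow> joins m' v"
  using assms by (cases v) auto

lemma ends_arcs_of: "v \<in> V \<Longrightarrow> x \<in> ends v \<Longrightarrow> x \<in> arcs_of V"
  by (auto simp: arcs_of_def)

lemma over_in_ends: "over_in v \<in> ends v" "under_in v \<in> ends v"
  by (cases v; simp)+

text \<open>A cut labelling of \<open>D\<close> is changed only on the arcs of \<open>I\<close>,
  which do not meet \<open>R\<close>. By \<open>loc\<close> the result is a cut labelling of
  \<open>D'\<close> with the same total weight, and \<open>nabla_J_smoothing\<close> computes both
  sides. If the smoothed crossings lie in the disc, \<open>loc\<close> deals with joins instead of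
  shifts there.\<close>

lemma nabla_J_replace:
  assumes D: "link_diagram D" "link_diagram D'"
    and V: "verts D = T \<union> R" "T \<inter> R = {}" "verts D' = T' \<union> R" "T' \<inter> R = {}"
    and lab: "\<And>x. x \<in> arcs_of R \<Longrightarrow> lab D' x = lab D x"
    and I: "arcs_of R \<inter> I = {}"
    and c: "c \<in> T \<and> c' \<in> T' \<or> c \<in> R \<and> c' = c"
    and mix: "mixed D c" "mixed D' c'" "kept_at ko D' c' = kept_at ko D c"
    and loc: "\<And>m \<kappa>. \<forall>v\<in>T - {c}. shifts (eps D \<kappa>) m v \<Longrightarrow> c \<in> T \<longrightarrow> joins m c \<Longrightarrow>
       \<exists>m'. (\<forall>x. x \<notin> I \<longrightarrow> m' x = m x) \<and> (\<forall>v\<in>T' - {c'}. shifts (eps D' \<kappa>) m' v) \<and>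
         (c' \<in> T' \<longrightarrow> joins m' c') \<and>
         (\<Sum>v\<in>T' - {c'}. weight n (eps D' \<kappa>) m' v) = (\<Sum>v\<in>T - {c}. weight n (eps D \<kappa>) m v)"
  shows "nabla_J n (smoothing ko D' c') = nabla_J n (smoothing ko D c)"
proof -
  define \<kappa> where "\<kappa> = kept_at ko D c"
  have cV: "c \<in> verts D" "c' \<in> verts D'" using c V by auto
  obtain m where m: "cut_labelling (verts D) (eps D \<kappa>) c m"
    using exists_cut_labelling[OF D(1) cV(1) mix(1)] by blast
  then have "\<forall>v\<in>T - {c}. shifts (eps D \<kappa>) m v" "c \<in> T \<longrightarrow> joins m c"
    unfolding cut_labelling_def V by auto
  from loc[OF this] obtain m' where m': "\<And>x. x \<notin> I \<Longrightarrow> m' x = m x"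
      "\<forall>v\<in>T' - {c'}. shifts (eps D' \<kappa>) m' v" "c' \<in> T' \<longrightarrow> joins m' c'"
      "(\<Sum>v\<in>T' - {c'}. weight n (eps D' \<kappa>) m' v) = (\<Sum>v\<in>T - {c}. weight n (eps D \<kappa>) m v)"
    by blast
  have RR: "R - {c'} = R - {c}" using c V by auto
  have agree: "m' x = m x" "eps D' \<kappa> x = eps D \<kappa> x" if "v \<in> R" "x \<in> ends v" for v x
    using ends_arcs_of[OF that] lab[of x] I m'(1)[of x] by (auto simp: eps_def)
  have "cut_labelling (verts D') (eps D' \<kappa>) c' m'"
    unfolding cut_labelling_def
  proof (intro conjI ballI)
    fix v assume v: "v \<in> verts D' - {c'}"
    show "shifts (eps D' \<kappa>) m' v"
    proof (cases "v \<in> T'")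
      case True
      then show ?thesis using m' v by blast
    next
      case False
      then have vR: "v \<in> R - {c}" using v V RR by blast
      then have "shifts (eps D \<kappa>) m v" using m V by (auto simp: cut_labelling_def)
      then show ?thesis using shifts_cong[of v m' m] agree[of v] vR by blast
    qed
  next
    show "joins m' c'"
    proof (cases "c' \<in> T'")
      case True
      then show ?thesis using m' by blast
    next
      case False
      then have "c' \<in> R" "c' = c" using c by auto
      then show ?thesis using joins_cong[of c' m' m] agree[of c'] m by (auto simp: cut_labelling_def)
    qed
  qed
  then have "nabla_J n (smoothing ko D' c') = (\<Sum>v\<in>verts D' - {c'}. weight n (eps D' \<kappa>) m' v)"
    using nabla_J_smoothing[OF D(2) cV(2) mix(2), of ko m' n] mix(3) by (simp add: \<kappa>_def)
  also have "\<dots> = (\<Sum>v\<in>T' - {c'}. weight n (eps D' \<kappa>) m' v) + (\<Sum>v\<in>R - {c'}. weight n (eps D' \<kappa>) m' v)"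
    unfolding V Un_Diff using D(2) V by (intro sum.union_disjoint) (auto simp: link_diagram_def)
  also have "(\<Sum>v\<in>R - {c'}. weight n (eps D' \<kappa>) m' v) = (\<Sum>v\<in>R - {c}. weight n (eps D \<kappa>) m v)"
    unfolding RR
  proof (rule sum.cong[OF refl])
    fix v assume "v \<in> R - {c}"
    then show "weight n (eps D' \<kappa>) m' v = weight n (eps D \<kappa>) m v"
      by (intro weight_cong agree) auto
  qed
  also have "(\<Sum>v\<in>T' - {c'}. weight n (eps D' \<kappa>) m' v) + \<dots> =
      (\<Sum>v\<in>T - {c}. weight n (eps D \<kappa>) m v) + (\<Sum>v\<in>R - {c}. weight n (eps D \<kappa>) m v)"
    using m'(4) by simp
  also have "\<dots> = (\<Sum>v\<in>verts D - {c}. weight n (eps D \<kappa>) m v)"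
    unfolding V Un_Diff using D(1) V
    by (intro sum.union_disjoint[symmetric]) (auto simp: link_diagram_def)
  also have "\<dots> = nabla_J n (smoothing ko D c)"
    using nabla_J_smoothing[OF D(1) cV(1) mix(1), of ko m n] m by (simp add: \<kappa>_def)
  finally show ?thesis .
qed

text \<open>\<open>P\<close> is a test function for \<open>nabla_J\<close>: the indicator of
  \<open>k\<close> gives \<open>span\<close>, the sum of the indicators of \<open>k\<close> and
  \<open>- k\<close> gives \<open>fspan\<close>. The factor depending on \<open>K1\<close> carries
  the signs with which \<open>over_set\<close> and \<open>under_set\<close> enter.\<close>

definition contribution :: "(int \<Rightarrow> int) \<Rightarrow> int \<Rightarrow> bool \<Rightarrow> diagram \<Rightarrow> vert \<Rightarrow> int" where
  "contribution P n ko D c =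
     (if mixed D c
      then sign c * (if lab D (over_in c) = K1 then 1 else - 1) * P (nabla_J n (smoothing ko D c))
      else 0)"

definition total :: "(int \<Rightarrow> int) \<Rightarrow> int \<Rightarrow> bool \<Rightarrow> diagram \<Rightarrow> int" where
  "total P n ko D = (\<Sum>c\<in>verts D. contribution P n ko D c)"

lemma span_eq_total:
  assumes "finite (verts D)"
  shows "span ko n k D = total (\<lambda>x. of_bool (x = k)) n ko D"
proof -
  have "span ko n k D =
    (\<Sum>c\<in>verts D. if c \<in> over_set D \<inter> I_set ko n k D then sign c else 0) -
    (\<Sum>c\<in>verts D. if c \<in> under_set D \<inter> I_set ko n k D then sign c else 0)"
    unfolding span_def using assms
    by (intro arg_cong2[of _ _ _ _ "(-)"] sum.mono_neutral_cong_left)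
      (auto simp: over_set_def under_set_def)
  also have "\<dots> = total (\<lambda>x. of_bool (x = k)) n ko D"
    unfolding total_def sum_subtractf[symmetric]
  proof (rule sum.cong[OF refl])
    fix c assume "c \<in> verts D"
    then show "(if c \<in> over_set D \<inter> I_set ko n k D then sign c else 0) -
        (if c \<in> under_set D \<inter> I_set ko n k D then sign c else 0) =
        contribution (\<lambda>x. of_bool (x = k)) n ko D c"
      by (cases "lab D (over_in c)"; cases "lab D (under_in c)")
        (auto simp: over_set_def under_set_def I_set_def contribution_def mixed_def)
  qed
  finally show ?thesis .
qed

lemma fspan_eq_total:
  assumes "finite (verts D)"
  shows "fspan ko n k D = total (\<lambda>x. of_bool (x = k) + of_bool (x = - k)) n ko D"
  unfolding fspan_def span_eq_total[OF assms] total_def sum.distrib[symmetric]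
  by (rule sum.cong[OF refl]) (simp add: contribution_def algebra_simps)

text \<open>A crossing outside the disc keeps its \<open>nabla_J\<close>, because \<open>loc\<close>
  carries labellings across the disc. The crossings inside are compared only through their sum,
  which leaves room for the cancellation in RII.\<close>

lemma total_replace:
  assumes D: "link_diagram D" "link_diagram D'"
    and V: "verts D = T \<union> R" "T \<inter> R = {}" "verts D' = T' \<union> R" "T' \<inter> R = {}"
    and lab: "\<And>x. x \<in> arcs_of R \<Longrightarrow> lab D' x = lab D x"
    and I: "arcs_of R \<inter> I = {}"
    and T: "(\<Sum>c\<in>T'. contribution P n ko D' c) = (\<Sum>c\<in>T. contribution P n ko D c)"
    and loc: "\<And>m \<kappa>. \<forall>v\<in>T. shifts (eps D \<kappa>) m v \<Longrightarrow>
       \<exists>m'. (\<forall>x. x \<notin> I \<longrightarrow> m' x = m x) \<and> (\<forall>v\<in>T'. shifts (eps D' \<kappa>) m' v) \<and>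
         (\<Sum>v\<in>T'. weight n (eps D' \<kappa>) m' v) = (\<Sum>v\<in>T. weight n (eps D \<kappa>) m v)"
  shows "total P n ko D' = total P n ko D"
proof -
  have R: "contribution P n ko D' c = contribution P n ko D c" if c: "c \<in> R" for c
  proof -
    have l: "lab D' (over_in c) = lab D (over_in c)" "lab D' (under_in c) = lab D (under_in c)"
      using lab ends_arcs_of[OF c] over_in_ends by blast+
    then have mix: "mixed D' c \<longleftrightarrow> mixed D c" and kept: "kept_at ko D' c = kept_at ko D c"
      by (simp_all add: mixed_def kept_at_def)
    have nT: "T - {c} = T" "T' - {c} = T'" "c \<notin> T" "c \<notin> T'" using c V by auto
    have "nabla_J n (smoothing ko D' c) = nabla_J n (smoothing ko D c)" if "mixed D c"
    proof (rule nabla_J_replace[OF D V])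
      show "c \<in> T \<and> c \<in> T' \<or> c \<in> R \<and> c = c" using c by simp
    next
      fix m \<kappa>
      assume "\<forall>v\<in>T - {c}. shifts (eps D \<kappa>) m v"
      then show "\<exists>m'. (\<forall>x. x \<notin> I \<longrightarrow> m' x = m x) \<and> (\<forall>v\<in>T' - {c}. shifts (eps D' \<kappa>) m' v) \<and>
         (c \<in> T' \<longrightarrow> joins m' c) \<and>
         (\<Sum>v\<in>T' - {c}. weight n (eps D' \<kappa>) m' v) = (\<Sum>v\<in>T - {c}. weight n (eps D \<kappa>) m v)"
        using loc[of \<kappa> m] unfolding nT(1,2) using nT(4) by blast
    qed (use that mix kept lab I in auto)
    then show ?thesis unfolding contribution_def mix l by simp
  qed
  have fin: "finite T" "finite T'" "finite R" using D V by (auto simp: link_diagram_def)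
  have "total P n ko D' = (\<Sum>c\<in>T'. contribution P n ko D' c) + (\<Sum>c\<in>R. contribution P n ko D' c)"
    unfolding total_def V using fin V by (intro sum.union_disjoint) auto
  also have "\<dots> = (\<Sum>c\<in>T. contribution P n ko D c) + (\<Sum>c\<in>R. contribution P n ko D c)"
    using T R by (simp cong: sum.cong)
  also have "\<dots> = total P n ko D"
    unfolding total_def V using fin V by (intro sum.union_disjoint[symmetric]) auto
  finally show ?thesis .
qed

text \<open>An inner arc enters a vertex of \<open>T'\<close> and leaves a vertex of
  \<open>T'\<close>, so by matching it meets no vertex of the common rest.\<close>

lemma replaces_frame:
  assumes rep: "replaces T T' I \<phi> D D'" and D': "link_diagram D'"
    and I: "\<And>i. i \<in> I \<Longrightarrow> \<exists>v\<in>T'. i \<in> set (ins v)" "\<And>i. i \<in> I \<Longrightarrow> \<exists>v\<in>T'. i \<in> set (outs v)"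
  obtains R where "verts D = T \<union> R" "T \<inter> R = {}" "verts D' = T' \<union> R" "T' \<inter> R = {}"
    "\<And>x. x \<in> arcs_of R \<Longrightarrow> lab D' x = lab D x" "arcs_of R \<inter> I = {}"
proof -
  define R where "R = verts D - T"
  have V: "verts D = T \<union> R" "T \<inter> R = {}" "verts D' = T' \<union> R" "T' \<inter> R = {}"
    using rep unfolding replaces_def R_def by blast+
  have M: "arcs_matched (verts D')" using D' by (simp add: link_diagram_def)
  have RI: "arcs_of R \<inter> I = {}"
  proof (rule ccontr)
    assume "arcs_of R \<inter> I \<noteq> {}"
    then obtain i v where i: "i \<in> I" "v \<in> R" "i \<in> set (ins v) \<or> i \<in> set (outs v)"
      unfolding arcs_of_def by blast
    obtain w u where w: "w \<in> T'" "i \<in> set (ins w)" and u: "u \<in> T'" "i \<in> set (outs u)"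
      using I i(1) by blast
    have "v \<in> T'"
      using i(3) ins_unique[OF M, of v w i] outs_unique[OF M, of v u i] i(2) w u V(3) by blast
    then show False using i(2) V(4) by blast
  qed
  moreover have "lab D' x = lab D x" if "x \<in> arcs_of R" for x
  proof -
    have "x \<in> arcs D - I" using that RI V(1) by (auto simp: arcs_of_def)
    then show ?thesis using rep unfolding replaces_def by simp
  qed
  ultimately show thesis using that V by blast
qed

section \<open>RI and RII\<close>

lemma eps_eq: "lab D x = lab D y \<Longrightarrow> eps D \<kappa> x = eps D \<kappa> y"
  by (simp add: eps_def)

lemma lab_cross:
  assumes "link_diagram D" "cross s t k e0 e1 e2 e3 \<in> verts D"
  shows "lab D e2 = lab D e0" "lab D e3 = lab D e1"
  using assms by (cases s; cases t; auto dest: lab_Crossing)+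

lemma mixed_cross:
  assumes "lab D e2 = lab D e0" "lab D e3 = lab D e1"
  shows "mixed D (cross s t k e0 e1 e2 e3) \<longleftrightarrow> k \<noteq> Virtual \<and> lab D e0 \<noteq> lab D e1"
  using lab_over_cross[where l = "lab D", OF _ assms] by (auto simp: mixed_def split: if_splits)

lemma kept_at_cross:
  assumes "lab D e2 = lab D e0" "lab D e3 = lab D e1" "k \<noteq> Virtual"
  shows "kept_at ko D (cross s t k e0 e1 e2 e3) = (if ko \<longleftrightarrow> k = OverL then lab D e0 else lab D e1)"
  using lab_over_cross[where l = "lab D", OF assms(3,1,2)] by (auto simp: kept_at_def)

lemma contribution_cross:
  assumes "lab D e2 = lab D e0" "lab D e3 = lab D e1"
  shows "contribution P n ko D (cross s t k e0 e1 e2 e3) =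
    (if k \<noteq> Virtual \<and> lab D e0 \<noteq> lab D e1
     then sgn_of s * sgn_of t * sign (Crossing k e0 e1 e3 e2) *
       (if (if k = OverL then lab D e0 else lab D e1) = K1 then 1 else - 1) *
       P (nabla_J n (smoothing ko D (cross s t k e0 e1 e2 e3)))
     else 0)"
  unfolding contribution_def mixed_cross[OF assms] sign_cross
  using lab_over_cross(1)[where l = "lab D", OF _ assms] by simp

text \<open>The kink is a crossing of a component with itself, so it contributes nothing. The label
  of the loop \<open>l\<close> cancels in the weight, whose argument is \<open>m a - m b\<close> up
  to sign, hence 0.\<close>

lemma total_R1:
  assumes D: "link_diagram D" "link_diagram D'"
    and rep: "replaces {Point a b} {v} {l} \<phi> D D'" and l: "l \<notin> {a, b}"
    and v: "v = Crossing k a l b l \<or> v = Crossing k l a l b"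
  shows "total P n ko D' = total P n ko D"
proof -
  obtain R where R: "verts D = {Point a b} \<union> R" "{Point a b} \<inter> R = {}"
    "verts D' = {v} \<union> R" "{v} \<inter> R = {}"
    "\<And>x. x \<in> arcs_of R \<Longrightarrow> lab D' x = lab D x" "arcs_of R \<inter> {l} = {}"
    by (rule replaces_frame[OF rep D(2)]) (use v in auto)
  have "a \<in> arcs D - {l}"
    using R(1) l by (auto simp: arcs_of_def)
  then have la: "lab D' a = lab D a" using rep by (simp add: replaces_def)
  have ll: "lab D' l = lab D' a" "lab D' b = lab D' a"
    using v R(3) lab_Crossing[OF D(2), of k a l b l] lab_Crossing[OF D(2), of k l a l b] by auto
  have "contribution P n ko D' v = 0" "contribution P n ko D (Point a b) = 0"
    using v ll by (auto simp: contribution_def mixed_Crossing mixed_def[of D])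
  moreover have "\<exists>m'. (\<forall>x. x \<notin> {l} \<longrightarrow> m' x = m x) \<and> (\<forall>v\<in>{v}. shifts (eps D' \<kappa>) m' v) \<and>
         (\<Sum>v\<in>{v}. weight n (eps D' \<kappa>) m' v) = (\<Sum>v\<in>{Point a b}. weight n (eps D \<kappa>) m v)"
    if "\<forall>v\<in>{Point a b}. shifts (eps D \<kappa>) m v" for m \<kappa>
  proof (intro exI conjI)
    \<comment> \<open>The value at \<open>l\<close> is forced by one shift at the crossing; the
      other shift undoes it, in agreement with \<open>m b = m a\<close>.\<close>
    let ?m = "m(l := if k = Virtual then m a
      else m a + (if v = Crossing k a l b l then - eps D' \<kappa> a else eps D' \<kappa> a))"
    show "\<forall>x. x \<notin> {l} \<longrightarrow> ?m x = m x" by simp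
    have e: "eps D' \<kappa> l = eps D' \<kappa> a" using ll by (intro eps_eq)
    have "Crossing k l a l b \<noteq> Crossing k a l b l" using l by auto
    then show "\<forall>v\<in>{v}. shifts (eps D' \<kappa>) ?m v"
      using that l v e by auto
    show "(\<Sum>v\<in>{v}. weight n (eps D' \<kappa>) ?m v) = (\<Sum>v\<in>{Point a b}. weight n (eps D \<kappa>) m v)"
      using that l v e by (auto simp: add.commute)
  qed
  ultimately show ?thesis
    by (intro total_replace[OF D R]) simp_all
qed

text \<open>The two crossings have opposite signs and the same strand on top, so equal values of
  \<open>nabla_J\<close> make their contributions cancel. In the smoothings at other crossings their
  weights cancel.\<close>

lemma total_R2:
  assumes D: "link_diagram D" "link_diagram D'"
    and rep: "replaces {pt s a b, pt t c d} {cross s t k a c e f, cross t s (switch k) f e d b} {e, f} \<phi> D D'"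
    and ne: "pt s a b \<noteq> pt t c d" "e \<noteq> f" "{e, f} \<inter> {a, b, c, d} = {}"
  shows "total P n ko D' = total P n ko D"
proof -
  let ?X = "cross s t k a c e f" and ?Y = "cross t s (switch k) f e d b"
  obtain R where R: "verts D = {pt s a b, pt t c d} \<union> R" "{pt s a b, pt t c d} \<inter> R = {}"
    "verts D' = {?X, ?Y} \<union> R" "{?X, ?Y} \<inter> R = {}"
    "\<And>x. x \<in> arcs_of R \<Longrightarrow> lab D' x = lab D x" "arcs_of R \<inter> {e, f} = {}"
    by (rule replaces_frame[OF rep D(2)]) (cases s; cases t; auto)+
  have XY: "?X \<noteq> ?Y" "?Y \<noteq> ?X"
    using ne by (cases s; cases t; auto)+
  have "a \<in> arcs D - {e, f}" "c \<in> arcs D - {e, f}"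
    using R(1) ne by (cases s; cases t; auto simp: arcs_of_def)+
  then have lac: "lab D' a = lab D a" "lab D' c = lab D c" using rep by (simp_all add: replaces_def)
  have l: "lab D' e = lab D' a" "lab D' f = lab D' c" "lab D' b = lab D' a" "lab D' d = lab D' c"
    using lab_cross[OF D(2), of s t k a c e f] lab_cross[OF D(2), of t s "switch k" f e d b] R(3) by auto
  have ep: "eps D' \<kappa> e = eps D' \<kappa> a" "eps D' \<kappa> f = eps D' \<kappa> c"
    "eps D' \<kappa> b = eps D' \<kappa> a" "eps D' \<kappa> d = eps D' \<kappa> c" for \<kappa>
    using l by (auto intro!: eps_eq)
  have pt: "mixed D (pt s x y) \<longleftrightarrow> False" "weight n \<epsilon> m (pt s x y) = 0"
    "shifts \<epsilon> m (pt s x y) \<longleftrightarrow> m y = m x" for s x y \<epsilon> m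
    by (cases s; auto simp: mixed_def)+
  \<comment> \<open>The diagram is replaced by itself here: only the smoothed crossing moves, from
    \<open>?X\<close> to \<open>?Y\<close>, and only the labels of \<open>e\<close> and
    \<open>f\<close> change.\<close>
  have nab: "nabla_J n (smoothing ko D' ?Y) = nabla_J n (smoothing ko D' ?X)"
    if k: "k \<noteq> Virtual" and ac: "lab D' a \<noteq> lab D' c"
  proof (rule nabla_J_replace[OF D(2) D(2) R(3,4) R(3,4)])
    show "mixed D' ?X" "mixed D' ?Y" using l k ac by (simp_all add: mixed_cross)
    show "kept_at ko D' ?Y = kept_at ko D' ?X"
      using l k by (cases k) (auto simp: kept_at_cross)
    show "arcs_of R \<inter> {e, f} = {}" by fact
    show "?X \<in> {?X, ?Y} \<and> ?Y \<in> {?X, ?Y} \<or> ?X \<in> R \<and> ?Y = ?X" by simp_all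
  next
    fix m \<kappa>
    assume "\<forall>v\<in>{?X, ?Y} - {?X}. shifts (eps D' \<kappa>) m v" "?X \<in> {?X, ?Y} \<longrightarrow> joins m ?X"
    then have Y: "shifts (eps D' \<kappa>) m ?Y" and X: "joins m ?X" using XY by auto
    have e: "eps D' \<kappa> c = - eps D' \<kappa> a"
      using ac by (cases "lab D' a"; cases "lab D' c"; cases \<kappa>) (auto simp: eps_def)
    \<comment> \<open>These values are forced at \<open>?X\<close> by the labels of \<open>a\<close>
      and \<open>c\<close>, now that \<open>?X\<close> is no longer the smoothed crossing.\<close>
    define m' where "m' = m(e := m a - sgn_of t * eps D' \<kappa> c, f := m c + sgn_of s * eps D' \<kappa> a)"
    have val: "m' a = m a" "m' b = m b" "m' c = m c" "m' d = m d"
      "m' e = m a - sgn_of t * eps D' \<kappa> c" "m' f = m c + sgn_of s * eps D' \<kappa> a"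
      using ne by (auto simp: m'_def)
    have 1: "shifts (eps D' \<kappa>) m' ?X" "joins m' ?Y"
      using X Y k by (auto simp: shifts_cross joins_cross ep e val split: if_splits)
    have 2: "weight n (eps D' \<kappa>) m' ?X = weight n (eps D' \<kappa>) m ?Y"
    proof -
      have "m' a + m' e - (m' c + m' f) = m f + m d - (m e + m b)"
        using X Y k by (auto simp: shifts_cross joins_cross ep e val split: if_splits)
      then show ?thesis by (simp add: weight_cross ep mult.commute mult.left_commute)
    qed
    have sets: "{?X, ?Y} - {?X} = {?Y}" "{?X, ?Y} - {?Y} = {?X}" using XY by auto
    show "\<exists>m'. (\<forall>x. x \<notin> {e, f} \<longrightarrow> m' x = m x) \<and> (\<forall>v\<in>{?X, ?Y} - {?Y}. shifts (eps D' \<kappa>) m' v) \<and>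
         (?Y \<in> {?X, ?Y} \<longrightarrow> joins m' ?Y) \<and>
         (\<Sum>v\<in>{?X, ?Y} - {?Y}. weight n (eps D' \<kappa>) m' v) = (\<Sum>v\<in>{?X, ?Y} - {?X}. weight n (eps D' \<kappa>) m v)"
      unfolding sets using 1 2 by (intro exI[of _ m']) (simp add: m'_def)
  qed simp_all
  have "contribution P n ko D' ?X + contribution P n ko D' ?Y = 0"
    using l nab by (cases k) (simp_all add: contribution_cross)
  then have T: "(\<Sum>v\<in>{?X, ?Y}. contribution P n ko D' v) = (\<Sum>v\<in>{pt s a b, pt t c d}. contribution P n ko D v)"
    using XY ne(1) by (simp add: contribution_def[of _ _ _ D] pt)
  have loc: "\<exists>m'. (\<forall>x. x \<notin> {e, f} \<longrightarrow> m' x = m x) \<and> (\<forall>v\<in>{?X, ?Y}. shifts (eps D' \<kappa>) m' v) \<and>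
         (\<Sum>v\<in>{?X, ?Y}. weight n (eps D' \<kappa>) m' v) = (\<Sum>v\<in>{pt s a b, pt t c d}. weight n (eps D \<kappa>) m v)"
    if m: "\<forall>v\<in>{pt s a b, pt t c d}. shifts (eps D \<kappa>) m v" for m \<kappa>
  proof -
    define m' where "m' = m(e := if k = Virtual then m a else m a - sgn_of t * eps D' \<kappa> c,
      f := if k = Virtual then m c else m c + sgn_of s * eps D' \<kappa> a)"
    have mbd: "m b = m a" "m d = m c" using m by (auto simp: pt)
    have val: "m' a = m a" "m' b = m a" "m' c = m c" "m' d = m c"
      "m' e = (if k = Virtual then m a else m a - sgn_of t * eps D' \<kappa> c)"
      "m' f = (if k = Virtual then m c else m c + sgn_of s * eps D' \<kappa> a)"
      using ne mbd by (auto simp: m'_def)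
    have "\<forall>v\<in>{?X, ?Y}. shifts (eps D' \<kappa>) m' v"
      by (simp add: shifts_cross ep val)
    \<comment> \<open>The shifts at \<open>?Y\<close> undo those at \<open>?X\<close>, so the
      argument of \<open>bump\<close> only changes its sign.\<close>
    moreover have "bump n (m' f + m' d - (m' e + m' b)) = - bump n (m' a + m' e - (m' c + m' f))"
      unfolding bump_minus[symmetric] val by (rule arg_cong[of _ _ "bump n"]) simp
    then have "weight n (eps D' \<kappa>) m' ?X + weight n (eps D' \<kappa>) m' ?Y = 0"
      by (simp add: weight_cross ep mult.commute mult.left_commute)
    then have "(\<Sum>v\<in>{?X, ?Y}. weight n (eps D' \<kappa>) m' v) = (\<Sum>v\<in>{pt s a b, pt t c d}. weight n (eps D \<kappa>) m v)"
      using XY ne(1) by (simp add: pt)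
    moreover have "\<forall>x. x \<notin> {e, f} \<longrightarrow> m' x = m x" by (simp add: m'_def)
    ultimately show ?thesis by blast
  qed
  show ?thesis
    by (rule total_replace[OF D R]) (use T loc in auto)
qed

section \<open>RIII\<close>

text \<open>Here \<open>x0, \<dots>, x3\<close> are the labels at the arcs \<open>e0, \<dots>, e3\<close> of a \<open>cross\<close>, \<open>v\<close> says that
  it is virtual, and \<open>d0, d1\<close> are \<open>\<epsilon>\<close> on its strands times the signs of their directions.\<close>

definition xshift :: "bool \<Rightarrow> int \<Rightarrow> int \<Rightarrow> int \<Rightarrow> int \<Rightarrow> int \<Rightarrow> int \<Rightarrow> bool" where
  "xshift v d0 d1 x0 x1 x2 x3 \<longleftrightarrow>
     x2 = x0 - (if v then 0 else d1) \<and> x3 = x1 + (if v then 0 else d0)"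

definition xweight :: "(int \<Rightarrow> int) \<Rightarrow> bool \<Rightarrow> int \<Rightarrow> int \<Rightarrow> int \<Rightarrow> int \<Rightarrow> int \<Rightarrow> int \<Rightarrow> int" where
  "xweight f v d0 d1 x0 x1 x2 x3 = (if v then 0 else d0 * d1 * f (x0 + x2 - (x1 + x3)))"

definition xjoin :: "int \<Rightarrow> int \<Rightarrow> int \<Rightarrow> int \<Rightarrow> int \<Rightarrow> int \<Rightarrow> bool" where
  "xjoin d0 d1 x0 x1 x2 x3 \<longleftrightarrow>
     (if d0 = - d1 then x1 = x0 \<and> x3 = x2 else x3 = x0 \<and> x2 = x1)"

text \<open>The assumption \<open>v\<close> admits three, one or no classical crossings and excludes
  the forbidden moves with two. The third strand changes the difference of the labels at a crossing
  equally in both triangles, so each crossing keeps its weight. The witnesses follow the strands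
  from \<open>p1\<close>, \<open>p2\<close>, \<open>p3\<close>.\<close>

lemma triangle_free:
  assumes v: "v12 = v13 \<and> v13 = v23 \<or> v12 \<noteq> v13 \<and> v23 \<or> v12 \<and> v13 \<and> \<not> v23"
    and "xshift v12 d1 d2 p1 p2 m1 m2" "xshift v13 d1 d3 m1 p3 q1 m3" "xshift v23 d2 d3 m2 m3 q2 q3"
  shows "\<exists>n1 n2 n3. xshift v23 d2 d3 p2 p3 n2 n3 \<and> xshift v13 d1 d3 p1 n3 n1 q3 \<and>
    xshift v12 d1 d2 n1 n2 q1 q2 \<and>
    xweight f v23 d2 d3 p2 p3 n2 n3 + xweight f v13 d1 d3 p1 n3 n1 q3 + xweight f v12 d1 d2 n1 n2 q1 q2 =
    xweight f v12 d1 d2 p1 p2 m1 m2 + xweight f v13 d1 d3 m1 p3 q1 m3 + xweight f v23 d2 d3 m2 m3 q2 q3"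
  by (rule exI[of _ "p1 - (if v13 then 0 else d3)"], rule exI[of _ "p2 - (if v23 then 0 else d3)"],
      rule exI[of _ "p3 + (if v23 then 0 else d2)"])
    (use assms in \<open>cases v12; cases v13; cases v23; clarsimp simp: xshift_def xweight_def; simp add: algebra_simps\<close>)

text \<open>If \<open>d1 = - d2\<close>, the smoothing joins \<open>p1\<close> to \<open>p2\<close>
  and strand 3 crosses one arc twice, with cancelling weights, on either side of the move. Otherwise
  the ends are joined across the crossing, and the move exchanges the weights of the crossings 13
  and 23.\<close>

lemma triangle_cut12:
  assumes v: "v13 = v23" and d: "d1 = d2 \<or> d1 = - d2"
    and "xjoin d1 d2 p1 p2 m1 m2" "xshift v13 d1 d3 m1 p3 q1 m3" "xshift v23 d2 d3 m2 m3 q2 q3"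
  shows "\<exists>n1 n2 n3. xshift v23 d2 d3 p2 p3 n2 n3 \<and> xshift v13 d1 d3 p1 n3 n1 q3 \<and>
    xjoin d1 d2 n1 n2 q1 q2 \<and>
    xweight f v23 d2 d3 p2 p3 n2 n3 + xweight f v13 d1 d3 p1 n3 n1 q3 =
    xweight f v13 d1 d3 m1 p3 q1 m3 + xweight f v23 d2 d3 m2 m3 q2 q3"
  by (rule exI[of _ "p1 - (if v13 then 0 else d3)"], rule exI[of _ "p2 - (if v23 then 0 else d3)"],
      rule exI[of _ "p3 + (if v23 then 0 else d2)"])
    (use assms in \<open>cases v13; cases v23; cases "d1 = - d2";
      auto simp: xshift_def xweight_def xjoin_def algebra_simps\<close>)

text \<open>Again the two weights cancel or are exchanged. Strand 2 is the second strand at crossing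
  12 but the first at crossing 23, which negates the argument; hence the oddness of
  \<open>f\<close>.\<close>

lemma triangle_cut13:
  assumes v: "v12 = v23" and d: "d1 = d3 \<or> d1 = - d3" and odd: "\<And>x. f (- x) = - f x"
    and "xshift v12 d1 d2 p1 p2 m1 m2" "xjoin d1 d3 m1 p3 q1 m3" "xshift v23 d2 d3 m2 m3 q2 q3"
  shows "\<exists>n1 n2 n3. xshift v23 d2 d3 p2 p3 n2 n3 \<and> xjoin d1 d3 p1 n3 n1 q3 \<and>
    xshift v12 d1 d2 n1 n2 q1 q2 \<and>
    xweight f v23 d2 d3 p2 p3 n2 n3 + xweight f v12 d1 d2 n1 n2 q1 q2 =
    xweight f v12 d1 d2 p1 p2 m1 m2 + xweight f v23 d2 d3 m2 m3 q2 q3"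
proof -
  have cancel: "d2 * (d3 * f (x - y)) + d2 * (d3 * f (y - x)) = 0" for x y
    using odd[of "x - y"] by simp
  show ?thesis
    \<comment> \<open>\<open>n1\<close> is computed back from \<open>q1\<close> through crossing 12,
      because strand 1 comes from \<open>p1\<close> through the smoothed crossing.\<close>
    by (rule exI[of _ "q1 + (if v12 then 0 else d2)"], rule exI[of _ "p2 - (if v23 then 0 else d3)"],
        rule exI[of _ "p3 + (if v23 then 0 else d2)"])
      (use assms(1,2,4-) in \<open>cases v12; cases v23; cases "d1 = - d3";
        auto simp: xshift_def xweight_def xjoin_def algebra_simps cancel\<close>)
qed

text \<open>As at crossing 12, the weights cancel or are exchanged. Here \<open>n2\<close> and
  \<open>n3\<close> are computed back from \<open>q2\<close> and \<open>q3\<close>, because strands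
  2 and 3 enter the triangle through the smoothed crossing.\<close>

lemma triangle_cut23:
  assumes v: "v12 = v13" and d: "d2 = d3 \<or> d2 = - d3"
    and "xshift v12 d1 d2 p1 p2 m1 m2" "xshift v13 d1 d3 m1 p3 q1 m3" "xjoin d2 d3 m2 m3 q2 q3"
  shows "\<exists>n1 n2 n3. xjoin d2 d3 p2 p3 n2 n3 \<and> xshift v13 d1 d3 p1 n3 n1 q3 \<and>
    xshift v12 d1 d2 n1 n2 q1 q2 \<and>
    xweight f v13 d1 d3 p1 n3 n1 q3 + xweight f v12 d1 d2 n1 n2 q1 q2 =
    xweight f v12 d1 d2 p1 p2 m1 m2 + xweight f v13 d1 d3 m1 p3 q1 m3"
  by (rule exI[of _ "p1 - (if v13 then 0 else d3)"], rule exI[of _ "q2 - (if v12 then 0 else d1)"],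
      rule exI[of _ "q3 - (if v13 then 0 else d1)"])
    (use assms in \<open>cases v12; cases v13; cases "d2 = - d3";
      auto simp: xshift_def xweight_def xjoin_def algebra_simps\<close>)

section \<open>Translation of crossings and labels into integer data\<close>

lemma shifts_cross_xshift:
  assumes "\<epsilon> e2 = \<epsilon> e0" "\<epsilon> e3 = \<epsilon> e1"
  shows "shifts \<epsilon> m (cross s t k e0 e1 e2 e3) \<longleftrightarrow>
    xshift (k = Virtual) (sgn_of s * \<epsilon> e0) (sgn_of t * \<epsilon> e1) (m e0) (m e1) (m e2) (m e3)"
  unfolding shifts_cross[OF assms] xshift_def by simp

lemma weight_cross_xweight:
  assumes "\<epsilon> e2 = \<epsilon> e0" "\<epsilon> e3 = \<epsilon> e1"
  shows "weight n \<epsilon> m (cross s t k e0 e1 e2 e3) =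
    xweight (bump n) (k = Virtual) (sgn_of s * \<epsilon> e0) (sgn_of t * \<epsilon> e1) (m e0) (m e1) (m e2) (m e3)"
  unfolding weight_cross[where \<epsilon> = \<epsilon>, OF assms] xweight_def by simp

text \<open>At a mixed crossing the strands have opposite \<open>\<epsilon>\<close>, so
  \<open>s = t\<close> means that the products of direction and \<open>\<epsilon>\<close> are
  opposite.\<close>

lemma joins_cross_xjoin:
  assumes "\<epsilon> e0 = - \<epsilon> e1" "\<epsilon> e1 \<noteq> 0"
  shows "joins m (cross s t k e0 e1 e2 e3) \<longleftrightarrow>
    xjoin (sgn_of s * \<epsilon> e0) (sgn_of t * \<epsilon> e1) (m e0) (m e1) (m e2) (m e3)"
  using assms unfolding joins_cross xjoin_def by (cases s; cases t) auto

lemma eps_mixed: "lab D x \<noteq> lab D y \<Longrightarrow> eps D \<kappa> x = - eps D \<kappa> y"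
  by (cases "lab D x"; cases "lab D y"; cases \<kappa>) (auto simp: eps_def)

lemma eps_neq_0: "eps D \<kappa> x \<noteq> 0"
  by (simp add: eps_def)

text \<open>Each crossing of the triangle keeps its sign, its upper strand and, if it is mixed, its
  \<open>nabla_J\<close>; the contributions agree one by one.\<close>

lemma total_R3:
  assumes D: "link_diagram D" "link_diagram D'"
    and kinds: "RIII_kinds k12 k13 k23 \<or> VRIII_kinds k12 k13 k23 \<or> SV_kinds k12 k13 k23"
    and rep: "replaces (triangle_above s1 s2 s3 k12 k13 k23 p1 p2 p3 q1 q2 q3 m1 m2 m3)
        (triangle_below s1 s2 s3 k12 k13 k23 p1 p2 p3 q1 q2 q3 m1 m2 m3) {m1, m2, m3} \<phi> D D'"
    and dist: "distinct [m1, m2, m3]" "{m1, m2, m3} \<inter> {p1, p2, p3, q1, q2, q3} = {}"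
  shows "total P n ko D' = total P n ko D"
proof -
  define X12 X13 X23 where X: "X12 = cross s1 s2 k12 p1 p2 m1 m2"
    "X13 = cross s1 s3 k13 m1 p3 q1 m3" "X23 = cross s2 s3 k23 m2 m3 q2 q3"
  define Y12 Y13 Y23 where Y: "Y12 = cross s1 s2 k12 m1 m2 q1 q2"
    "Y13 = cross s1 s3 k13 p1 m3 m1 q3" "Y23 = cross s2 s3 k23 p2 p3 m2 m3"
  have tri: "triangle_above s1 s2 s3 k12 k13 k23 p1 p2 p3 q1 q2 q3 m1 m2 m3 = {X12, X13, X23}"
    "triangle_below s1 s2 s3 k12 k13 k23 p1 p2 p3 q1 q2 q3 m1 m2 m3 = {Y12, Y13, Y23}"
    by (auto simp: triangle_above_def triangle_below_def X Y)
  note rep = rep[unfolded tri]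
  have endsX: "ends X12 = {p1, p2, m1, m2}" "ends X13 = {m1, p3, q1, m3}" "ends X23 = {m2, m3, q2, q3}"
    and endsY: "ends Y12 = {m1, m2, q1, q2}" "ends Y13 = {p1, m3, m1, q3}" "ends Y23 = {p2, p3, m2, m3}"
    unfolding X Y by (rule arcs_cross)+
  \<comment> \<open>Two crossings are told apart by an inner arc that meets only one of
    them.\<close>
  have neq: "X12 \<noteq> X13" "X12 \<noteq> X23" "X13 \<noteq> X23" "Y12 \<noteq> Y13" "Y12 \<noteq> Y23" "Y13 \<noteq> Y23"
  proof -
    have *: "v \<noteq> w" if "i \<in> ends v \<longleftrightarrow> i \<notin> ends w" for i v w using that by auto
    show "X12 \<noteq> X13" "X12 \<noteq> X23" by (rule *[of m3]; unfold endsX; use dist in auto)+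
    show "X13 \<noteq> X23" by (rule *[of m1]; unfold endsX; use dist in auto)
    show "Y12 \<noteq> Y13" by (rule *[of m3]; unfold endsY; use dist in auto)
    show "Y12 \<noteq> Y23" "Y13 \<noteq> Y23" by (rule *[of m1]; unfold endsY; use dist in auto)+
  qed
  obtain R where R: "verts D = {X12, X13, X23} \<union> R" "{X12, X13, X23} \<inter> R = {}"
    "verts D' = {Y12, Y13, Y23} \<union> R" "{Y12, Y13, Y23} \<inter> R = {}"
    "\<And>x. x \<in> arcs_of R \<Longrightarrow> lab D' x = lab D x" "arcs_of R \<inter> {m1, m2, m3} = {}"
    by (rule replaces_frame[OF rep D(2)]) (unfold Y, (cases s1; cases s2; cases s3; auto)+)
  have "{p1, p2, p3} \<subseteq> ends X12 \<union> ends X13"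
    unfolding endsX by auto
  also have "\<dots> \<subseteq> arcs D" using R(1) by (auto simp: arcs_of_def)
  finally have lp: "lab D' p1 = lab D p1" "lab D' p2 = lab D p2" "lab D' p3 = lab D p3"
    using rep dist unfolding replaces_def by auto
  have lX: "lab D m1 = lab D p1" "lab D m2 = lab D p2" "lab D m3 = lab D p3"
    "lab D q1 = lab D p1" "lab D q2 = lab D p2" "lab D q3 = lab D p3"
    using lab_cross[OF D(1), of s1 s2 k12 p1 p2 m1 m2] lab_cross[OF D(1), of s1 s3 k13 m1 p3 q1 m3]
      lab_cross[OF D(1), of s2 s3 k23 m2 m3 q2 q3] R(1) unfolding X by auto
  have lY: "lab D' m1 = lab D p1" "lab D' m2 = lab D p2" "lab D' m3 = lab D p3"
    "lab D' q1 = lab D p1" "lab D' q2 = lab D p2" "lab D' q3 = lab D p3"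
    using lab_cross[OF D(2), of s1 s2 k12 m1 m2 q1 q2] lab_cross[OF D(2), of s1 s3 k13 p1 m3 m1 q3]
      lab_cross[OF D(2), of s2 s3 k23 p2 p3 m2 m3] R(3) lp unfolding Y by auto
  define d1 d2 d3 where d: "d1 \<kappa> = sgn_of s1 * eps D \<kappa> p1" "d2 \<kappa> = sgn_of s2 * eps D \<kappa> p2"
    "d3 \<kappa> = sgn_of s3 * eps D \<kappa> p3" for \<kappa>
  have eX: "eps D \<kappa> m1 = eps D \<kappa> p1" "eps D \<kappa> m2 = eps D \<kappa> p2" "eps D \<kappa> m3 = eps D \<kappa> p3"
    "eps D \<kappa> q1 = eps D \<kappa> p1" "eps D \<kappa> q2 = eps D \<kappa> p2" "eps D \<kappa> q3 = eps D \<kappa> p3"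
    and eY: "eps D' \<kappa> m1 = eps D \<kappa> p1" "eps D' \<kappa> m2 = eps D \<kappa> p2" "eps D' \<kappa> m3 = eps D \<kappa> p3"
    "eps D' \<kappa> q1 = eps D \<kappa> p1" "eps D' \<kappa> q2 = eps D \<kappa> p2" "eps D' \<kappa> q3 = eps D \<kappa> p3"
    "eps D' \<kappa> p1 = eps D \<kappa> p1" "eps D' \<kappa> p2 = eps D \<kappa> p2" "eps D' \<kappa> p3 = eps D \<kappa> p3" for \<kappa>
    using lX lY lp by (simp_all add: eps_def)
  note conv = shifts_cross_xshift weight_cross_xweight eX eY d[symmetric]
  have shX: "shifts (eps D \<kappa>) m X12 \<longleftrightarrow> xshift (k12 = Virtual) (d1 \<kappa>) (d2 \<kappa>) (m p1) (m p2) (m m1) (m m2)"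
    "shifts (eps D \<kappa>) m X13 \<longleftrightarrow> xshift (k13 = Virtual) (d1 \<kappa>) (d3 \<kappa>) (m m1) (m p3) (m q1) (m m3)"
    "shifts (eps D \<kappa>) m X23 \<longleftrightarrow> xshift (k23 = Virtual) (d2 \<kappa>) (d3 \<kappa>) (m m2) (m m3) (m q2) (m q3)"
    and shY: "shifts (eps D' \<kappa>) m Y12 \<longleftrightarrow> xshift (k12 = Virtual) (d1 \<kappa>) (d2 \<kappa>) (m m1) (m m2) (m q1) (m q2)"
    "shifts (eps D' \<kappa>) m Y13 \<longleftrightarrow> xshift (k13 = Virtual) (d1 \<kappa>) (d3 \<kappa>) (m p1) (m m3) (m m1) (m q3)"
    "shifts (eps D' \<kappa>) m Y23 \<longleftrightarrow> xshift (k23 = Virtual) (d2 \<kappa>) (d3 \<kappa>) (m p2) (m p3) (m m2) (m m3)"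
    and wX: "weight n (eps D \<kappa>) m X12 = xweight (bump n) (k12 = Virtual) (d1 \<kappa>) (d2 \<kappa>) (m p1) (m p2) (m m1) (m m2)"
    "weight n (eps D \<kappa>) m X13 = xweight (bump n) (k13 = Virtual) (d1 \<kappa>) (d3 \<kappa>) (m m1) (m p3) (m q1) (m m3)"
    "weight n (eps D \<kappa>) m X23 = xweight (bump n) (k23 = Virtual) (d2 \<kappa>) (d3 \<kappa>) (m m2) (m m3) (m q2) (m q3)"
    and wY: "weight n (eps D' \<kappa>) m Y12 = xweight (bump n) (k12 = Virtual) (d1 \<kappa>) (d2 \<kappa>) (m m1) (m m2) (m q1) (m q2)"
    "weight n (eps D' \<kappa>) m Y13 = xweight (bump n) (k13 = Virtual) (d1 \<kappa>) (d3 \<kappa>) (m p1) (m m3) (m m1) (m q3)"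
    "weight n (eps D' \<kappa>) m Y23 = xweight (bump n) (k23 = Virtual) (d2 \<kappa>) (d3 \<kappa>) (m p2) (m p3) (m m2) (m m3)"
    for m \<kappa>
    unfolding X Y by (simp_all only: conv)
  \<comment> \<open>If one crossing is classical, the other two are both classical or both virtual;
    this is the assumption of the three lemmas on cut triangles.\<close>
  have K: "(k12 = Virtual) = (k13 = Virtual) \<and> (k13 = Virtual) = (k23 = Virtual) \<or>
      (k12 = Virtual) \<noteq> (k13 = Virtual) \<and> k23 = Virtual \<or> k12 = Virtual \<and> k13 = Virtual \<and> \<not> k23 = Virtual"
    using kinds by (auto simp: RIII_kinds_def VRIII_kinds_def SV_kinds_def split: if_splits)
  have pm: "d1 \<kappa> = d2 \<kappa> \<or> d1 \<kappa> = - d2 \<kappa>" "d1 \<kappa> = d3 \<kappa> \<or> d1 \<kappa> = - d3 \<kappa>" "d2 \<kappa> = d3 \<kappa> \<or> d2 \<kappa> = - d3 \<kappa>" for \<kappa>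
    unfolding d eps_def by auto
  define ext where "ext m n1 n2 n3 = m(m1 := n1, m2 := n2, m3 := n3)" for m :: "arc \<Rightarrow> int" and n1 n2 n3
  have ext: "ext m n1 n2 n3 p1 = m p1" "ext m n1 n2 n3 p2 = m p2" "ext m n1 n2 n3 p3 = m p3"
    "ext m n1 n2 n3 q1 = m q1" "ext m n1 n2 n3 q2 = m q2" "ext m n1 n2 n3 q3 = m q3"
    "ext m n1 n2 n3 m1 = n1" "ext m n1 n2 n3 m2 = n2" "ext m n1 n2 n3 m3 = n3"
    "\<forall>x. x \<notin> {m1, m2, m3} \<longrightarrow> ext m n1 n2 n3 x = m x" for m n1 n2 n3
    using dist by (auto simp: ext_def)
  have nab12: "nabla_J n (smoothing ko D' Y12) = nabla_J n (smoothing ko D X12)"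
    if k: "k12 \<noteq> Virtual" and ne: "lab D p1 \<noteq> lab D p2"
  proof (rule nabla_J_replace[OF D R])
    show "mixed D X12" "mixed D' Y12" "kept_at ko D' Y12 = kept_at ko D X12"
      unfolding X Y using lX lY lp k ne by (simp_all add: mixed_cross kept_at_cross)
    fix m \<kappa>
    assume m: "\<forall>v\<in>{X12, X13, X23} - {X12}. shifts (eps D \<kappa>) m v" "X12 \<in> {X12, X13, X23} \<longrightarrow> joins m X12"
    have j: "joins m X12 \<longleftrightarrow> xjoin (d1 \<kappa>) (d2 \<kappa>) (m p1) (m p2) (m m1) (m m2)"
      "joins m Y12 \<longleftrightarrow> xjoin (d1 \<kappa>) (d2 \<kappa>) (m m1) (m m2) (m q1) (m q2)" for m
      unfolding X Y d using eps_mixed[OF ne, of \<kappa>] eps_neq_0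
      by (simp_all add: joins_cross_xjoin[where \<epsilon> = "eps D \<kappa>"] eX)
    have "(k13 = Virtual) = (k23 = Virtual)" using K k by blast
    then obtain n1 n2 n3 where "xshift (k23 = Virtual) (d2 \<kappa>) (d3 \<kappa>) (m p2) (m p3) n2 n3"
      "xshift (k13 = Virtual) (d1 \<kappa>) (d3 \<kappa>) (m p1) n3 n1 (m q3)"
      "xjoin (d1 \<kappa>) (d2 \<kappa>) n1 n2 (m q1) (m q2)"
      "xweight (bump n) (k23 = Virtual) (d2 \<kappa>) (d3 \<kappa>) (m p2) (m p3) n2 n3 +
       xweight (bump n) (k13 = Virtual) (d1 \<kappa>) (d3 \<kappa>) (m p1) n3 n1 (m q3) =
       xweight (bump n) (k13 = Virtual) (d1 \<kappa>) (d3 \<kappa>) (m m1) (m p3) (m q1) (m m3) +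
       xweight (bump n) (k23 = Virtual) (d2 \<kappa>) (d3 \<kappa>) (m m2) (m m3) (m q2) (m q3)"
      using triangle_cut12[OF _ pm(1)[of \<kappa>], of "k13 = Virtual" "k23 = Virtual" "m p1" "m p2" "m m1" "m m2"
        "d3 \<kappa>" "m p3" "m q1" "m m3" "m q2" "m q3" "bump n"] m neq unfolding shX[symmetric] j[symmetric] by auto
    then show "\<exists>m'. (\<forall>x. x \<notin> {m1, m2, m3} \<longrightarrow> m' x = m x) \<and> (\<forall>v\<in>{Y12, Y13, Y23} - {Y12}. shifts (eps D' \<kappa>) m' v) \<and>
        (Y12 \<in> {Y12, Y13, Y23} \<longrightarrow> joins m' Y12) \<and>
        (\<Sum>v\<in>{Y12, Y13, Y23} - {Y12}. weight n (eps D' \<kappa>) m' v) =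
        (\<Sum>v\<in>{X12, X13, X23} - {X12}. weight n (eps D \<kappa>) m v)"
      using neq ext(10)
      by (intro exI[of _ "ext m n1 n2 n3"]) (simp add: insert_Diff_if shY wX wY j ext(1-9))
  qed simp_all
  have nab13: "nabla_J n (smoothing ko D' Y13) = nabla_J n (smoothing ko D X13)"
    if k: "k13 \<noteq> Virtual" and ne: "lab D p1 \<noteq> lab D p3"
  proof (rule nabla_J_replace[OF D R])
    show "mixed D X13" "mixed D' Y13" "kept_at ko D' Y13 = kept_at ko D X13"
      unfolding X Y using lX lY lp k ne by (simp_all add: mixed_cross kept_at_cross)
    fix m \<kappa>
    assume m: "\<forall>v\<in>{X12, X13, X23} - {X13}. shifts (eps D \<kappa>) m v" "X13 \<in> {X12, X13, X23} \<longrightarrow> joins m X13"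
    have j: "joins m X13 \<longleftrightarrow> xjoin (d1 \<kappa>) (d3 \<kappa>) (m m1) (m p3) (m q1) (m m3)"
      "joins m Y13 \<longleftrightarrow> xjoin (d1 \<kappa>) (d3 \<kappa>) (m p1) (m m3) (m m1) (m q3)" for m
      unfolding X Y d using eps_mixed[OF ne, of \<kappa>] eps_neq_0
      by (simp_all add: joins_cross_xjoin[where \<epsilon> = "eps D \<kappa>"] eX)
    have "(k12 = Virtual) = (k23 = Virtual)" using K k by blast
    then obtain n1 n2 n3 where "xshift (k23 = Virtual) (d2 \<kappa>) (d3 \<kappa>) (m p2) (m p3) n2 n3"
      "xjoin (d1 \<kappa>) (d3 \<kappa>) (m p1) n3 n1 (m q3)"
      "xshift (k12 = Virtual) (d1 \<kappa>) (d2 \<kappa>) n1 n2 (m q1) (m q2)"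
      "xweight (bump n) (k23 = Virtual) (d2 \<kappa>) (d3 \<kappa>) (m p2) (m p3) n2 n3 +
       xweight (bump n) (k12 = Virtual) (d1 \<kappa>) (d2 \<kappa>) n1 n2 (m q1) (m q2) =
       xweight (bump n) (k12 = Virtual) (d1 \<kappa>) (d2 \<kappa>) (m p1) (m p2) (m m1) (m m2) +
       xweight (bump n) (k23 = Virtual) (d2 \<kappa>) (d3 \<kappa>) (m m2) (m m3) (m q2) (m q3)"
      using triangle_cut13[where f = "bump n", OF _ pm(2)[of \<kappa>] bump_minus, of "k12 = Virtual" "k23 = Virtual" "d2 \<kappa>" "m p1" "m p2" "m m1" "m m2"
        "m p3" "m q1" "m m3" "m q2" "m q3"] m neq unfolding shX[symmetric] j[symmetric] by auto
    then show "\<exists>m'. (\<forall>x. x \<notin> {m1, m2, m3} \<longrightarrow> m' x = m x) \<and> (\<forall>v\<in>{Y12, Y13, Y23} - {Y13}. shifts (eps D' \<kappa>) m' v) \<and>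
        (Y13 \<in> {Y12, Y13, Y23} \<longrightarrow> joins m' Y13) \<and>
        (\<Sum>v\<in>{Y12, Y13, Y23} - {Y13}. weight n (eps D' \<kappa>) m' v) =
        (\<Sum>v\<in>{X12, X13, X23} - {X13}. weight n (eps D \<kappa>) m v)"
      using neq ext(10)
      by (intro exI[of _ "ext m n1 n2 n3"]) (simp add: insert_Diff_if shY wX wY j ext(1-9))
  qed simp_all
  have nab23: "nabla_J n (smoothing ko D' Y23) = nabla_J n (smoothing ko D X23)"
    if k: "k23 \<noteq> Virtual" and ne: "lab D p2 \<noteq> lab D p3"
  proof (rule nabla_J_replace[OF D R])
    show "mixed D X23" "mixed D' Y23" "kept_at ko D' Y23 = kept_at ko D X23"
      unfolding X Y using lX lY lp k ne by (simp_all add: mixed_cross kept_at_cross)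
    fix m \<kappa>
    assume m: "\<forall>v\<in>{X12, X13, X23} - {X23}. shifts (eps D \<kappa>) m v" "X23 \<in> {X12, X13, X23} \<longrightarrow> joins m X23"
    have j: "joins m X23 \<longleftrightarrow> xjoin (d2 \<kappa>) (d3 \<kappa>) (m m2) (m m3) (m q2) (m q3)"
      "joins m Y23 \<longleftrightarrow> xjoin (d2 \<kappa>) (d3 \<kappa>) (m p2) (m p3) (m m2) (m m3)" for m
      unfolding X Y d using eps_mixed[OF ne, of \<kappa>] eps_neq_0
      by (simp_all add: joins_cross_xjoin[where \<epsilon> = "eps D \<kappa>"] eX)
    have "(k12 = Virtual) = (k13 = Virtual)" using K k by blast
    then obtain n1 n2 n3 where "xjoin (d2 \<kappa>) (d3 \<kappa>) (m p2) (m p3) n2 n3"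
      "xshift (k13 = Virtual) (d1 \<kappa>) (d3 \<kappa>) (m p1) n3 n1 (m q3)"
      "xshift (k12 = Virtual) (d1 \<kappa>) (d2 \<kappa>) n1 n2 (m q1) (m q2)"
      "xweight (bump n) (k13 = Virtual) (d1 \<kappa>) (d3 \<kappa>) (m p1) n3 n1 (m q3) +
       xweight (bump n) (k12 = Virtual) (d1 \<kappa>) (d2 \<kappa>) n1 n2 (m q1) (m q2) =
       xweight (bump n) (k12 = Virtual) (d1 \<kappa>) (d2 \<kappa>) (m p1) (m p2) (m m1) (m m2) +
       xweight (bump n) (k13 = Virtual) (d1 \<kappa>) (d3 \<kappa>) (m m1) (m p3) (m q1) (m m3)"
      using triangle_cut23[OF _ pm(3)[of \<kappa>], of "k12 = Virtual" "k13 = Virtual" "d1 \<kappa>" "m p1" "m p2" "m m1" "m m2"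
        "m p3" "m q1" "m m3" "m q2" "m q3" "bump n"] m neq unfolding shX[symmetric] j[symmetric] by auto
    then show "\<exists>m'. (\<forall>x. x \<notin> {m1, m2, m3} \<longrightarrow> m' x = m x) \<and> (\<forall>v\<in>{Y12, Y13, Y23} - {Y23}. shifts (eps D' \<kappa>) m' v) \<and>
        (Y23 \<in> {Y12, Y13, Y23} \<longrightarrow> joins m' Y23) \<and>
        (\<Sum>v\<in>{Y12, Y13, Y23} - {Y23}. weight n (eps D' \<kappa>) m' v) =
        (\<Sum>v\<in>{X12, X13, X23} - {X23}. weight n (eps D \<kappa>) m v)"
      using neq ext(10)
      by (intro exI[of _ "ext m n1 n2 n3"]) (simp add: insert_Diff_if shY wX wY j ext(1-9))
  qed simp_all
  have con: "contribution P n ko D' Y12 = contribution P n ko D X12"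
    "contribution P n ko D' Y13 = contribution P n ko D X13"
    "contribution P n ko D' Y23 = contribution P n ko D X23"
    using nab12 nab13 nab23 lX lY lp unfolding X Y by (auto simp: contribution_cross cong: kind.case_cong)
  show ?thesis
  proof (rule total_replace[OF D R])
    show "(\<Sum>v\<in>{Y12, Y13, Y23}. contribution P n ko D' v) = (\<Sum>v\<in>{X12, X13, X23}. contribution P n ko D v)"
      using neq con by simp
    fix m \<kappa>
    assume m: "\<forall>v\<in>{X12, X13, X23}. shifts (eps D \<kappa>) m v"
    obtain n1 n2 n3 where "xshift (k23 = Virtual) (d2 \<kappa>) (d3 \<kappa>) (m p2) (m p3) n2 n3"
      "xshift (k13 = Virtual) (d1 \<kappa>) (d3 \<kappa>) (m p1) n3 n1 (m q3)"
      "xshift (k12 = Virtual) (d1 \<kappa>) (d2 \<kappa>) n1 n2 (m q1) (m q2)"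
      "xweight (bump n) (k23 = Virtual) (d2 \<kappa>) (d3 \<kappa>) (m p2) (m p3) n2 n3 +
       xweight (bump n) (k13 = Virtual) (d1 \<kappa>) (d3 \<kappa>) (m p1) n3 n1 (m q3) +
       xweight (bump n) (k12 = Virtual) (d1 \<kappa>) (d2 \<kappa>) n1 n2 (m q1) (m q2) =
       xweight (bump n) (k12 = Virtual) (d1 \<kappa>) (d2 \<kappa>) (m p1) (m p2) (m m1) (m m2) +
       xweight (bump n) (k13 = Virtual) (d1 \<kappa>) (d3 \<kappa>) (m m1) (m p3) (m q1) (m m3) +
       xweight (bump n) (k23 = Virtual) (d2 \<kappa>) (d3 \<kappa>) (m m2) (m m3) (m q2) (m q3)"
      using triangle_free[OF K, of "d1 \<kappa>" "d2 \<kappa>" "m p1" "m p2" "m m1" "m m2"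
        "d3 \<kappa>" "m p3" "m q1" "m m3" "m q2" "m q3" "bump n"] m unfolding shX[symmetric] by auto
    then show "\<exists>m'. (\<forall>x. x \<notin> {m1, m2, m3} \<longrightarrow> m' x = m x) \<and> (\<forall>v\<in>{Y12, Y13, Y23}. shifts (eps D' \<kappa>) m' v) \<and>
        (\<Sum>v\<in>{Y12, Y13, Y23}. weight n (eps D' \<kappa>) m' v) =
        (\<Sum>v\<in>{X12, X13, X23}. weight n (eps D \<kappa>) m v)"
      using neq ext(10)
      by (intro exI[of _ "ext m n1 n2 n3"]) (simp add: shY wX wY ext(1-9))
  qed simp_all
qed

section \<open>Redrawing and crossing changes\<close>

lemma map_vert_simps [simp]:
  "ins (map_vert \<phi> v) = map \<phi> (ins v)" "outs (map_vert \<phi> v) = map \<phi> (outs v)"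
  "classical (map_vert \<phi> v) = classical v" "sign (map_vert \<phi> v) = sign v"
  "over_in (map_vert \<phi> v) = \<phi> (over_in v)" "under_in (map_vert \<phi> v) = \<phi> (under_in v)"
  by (cases v; simp)+

lemma map_vert_labels:
  "shifts \<epsilon> m (map_vert \<phi> v) \<longleftrightarrow> shifts (\<epsilon> \<circ> \<phi>) (m \<circ> \<phi>) v"
  "weight n \<epsilon> m (map_vert \<phi> v) = weight n (\<epsilon> \<circ> \<phi>) (m \<circ> \<phi>) v"
  "joins m (map_vert \<phi> v) \<longleftrightarrow> joins (m \<circ> \<phi>) v"
  by (cases v; simp)+

text \<open>This covers renaming, with \<open>Q\<close> empty, and the removal of a point, with that
  point in \<open>Q\<close>. Labellings are pulled back from \<open>D'\<close> along
  \<open>\<phi>\<close>; at the points of \<open>Q\<close> they satisfy \<open>shifts\<close>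
  automatically, since \<open>\<phi>\<close> identifies the ends.\<close>

lemma total_map_vert:
  assumes D: "link_diagram D" "link_diagram D'"
    and Q: "Q \<subseteq> verts D" "\<And>v. v \<in> Q \<Longrightarrow> \<exists>a b. v = Point a b \<and> \<phi> a = \<phi> b"
    and inj: "inj_on \<phi> (\<Union>v\<in>verts D - Q. set (ins v))"
    and V: "verts D' = map_vert \<phi> ` (verts D - Q)"
    and lab: "\<And>x. x \<in> arcs D \<Longrightarrow> lab D' (\<phi> x) = lab D x"
  shows "total P n ko D' = total P n ko D"
proof -
  have M: "arcs_matched (verts D)" and fin: "finite (verts D)"
    using D by (auto simp: link_diagram_def)
  have inj_map: "inj_on (map_vert \<phi>) (verts D - Q)"
  proof (rule inj_onI)
    fix v w assume vw: "v \<in> verts D - Q" "w \<in> verts D - Q" "map_vert \<phi> v = map_vert \<phi> w"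
    obtain x where x: "x \<in> set (ins v)" by (cases v) auto
    have "\<phi> x \<in> \<phi> ` set (ins w)"
      using x arg_cong[OF vw(3), of "\<lambda>v. set (ins v)"] by auto
    then obtain y where y: "y \<in> set (ins w)" "\<phi> x = \<phi> y" by blast
    have "x = y" by (rule inj_onD[OF inj y(2)]) (use x y vw in auto)
    then show "v = w" using ins_unique[OF M, of v w x] x y vw by auto
  qed
  have arcs: "x \<in> arcs D" if "v \<in> verts D" "x \<in> ends v" for v x
    using that by (rule ends_arcs_of)
  have eps: "eps D' \<kappa> (\<phi> x) = eps D \<kappa> x" if "x \<in> arcs D" for \<kappa> x
    using lab[OF that] by (simp add: eps_def)
  have con: "contribution P n ko D' (map_vert \<phi> c) = contribution P n ko D c" if c: "c \<in> verts D - Q" for c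
  proof -
    have l: "lab D' (\<phi> (over_in c)) = lab D (over_in c)" "lab D' (\<phi> (under_in c)) = lab D (under_in c)"
      using lab arcs over_in_ends c by blast+
    have mix: "mixed D' (map_vert \<phi> c) \<longleftrightarrow> mixed D c"
      and kept: "kept_at ko D' (map_vert \<phi> c) = kept_at ko D c"
      using l by (auto simp: mixed_def kept_at_def)
    have "nabla_J n (smoothing ko D' (map_vert \<phi> c)) = nabla_J n (smoothing ko D c)" if m: "mixed D c"
    proof -
      define \<kappa> where "\<kappa> = kept_at ko D c"
      have c': "map_vert \<phi> c \<in> verts D'" using c V by auto
      obtain m' where m': "cut_labelling (verts D') (eps D' \<kappa>) (map_vert \<phi> c) m'"
        using exists_cut_labelling[OF D(2) c'] m mix by blast
      have conv: "shifts (eps D \<kappa>) (m' \<circ> \<phi>) v \<longleftrightarrow> shifts (eps D' \<kappa>) m' (map_vert \<phi> v)"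
        "weight n (eps D \<kappa>) (m' \<circ> \<phi>) v = weight n (eps D' \<kappa>) m' (map_vert \<phi> v)"
        if "v \<in> verts D" for v
        unfolding map_vert_labels using eps arcs[OF that]
        by (auto intro!: shifts_cong weight_cong)
      have minus: "verts D' - {map_vert \<phi> c} = map_vert \<phi> ` (verts D - Q - {c})"
        unfolding V using c inj_on_image_set_diff[OF inj_map, of "verts D - Q" "{c}"] by auto
      have "cut_labelling (verts D) (eps D \<kappa>) c (m' \<circ> \<phi>)"
        unfolding cut_labelling_def
      proof (intro conjI ballI)
        fix v assume v: "v \<in> verts D - {c}"
        show "shifts (eps D \<kappa>) (m' \<circ> \<phi>) v"
        proof (cases "v \<in> Q")
          case True
          then show ?thesis using Q(2)[OF True] by auto
        next
          case False
          then have "shifts (eps D' \<kappa>) m' (map_vert \<phi> v)"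
            using m' v minus by (auto simp: cut_labelling_def)
          then show ?thesis using conv(1) v by simp
        qed
      next
        show "joins (m' \<circ> \<phi>) c"
          using m' by (simp add: cut_labelling_def map_vert_labels)
      qed
      then have "nabla_J n (smoothing ko D c) = (\<Sum>v\<in>verts D - {c}. weight n (eps D \<kappa>) (m' \<circ> \<phi>) v)"
        using nabla_J_smoothing[OF D(1) _ m] c by (simp add: \<kappa>_def)
      also have "\<dots> = (\<Sum>v\<in>verts D - Q - {c}. weight n (eps D \<kappa>) (m' \<circ> \<phi>) v)"
      proof (rule sum.mono_neutral_right)
        show "\<forall>v\<in>verts D - {c} - (verts D - Q - {c}). weight n (eps D \<kappa>) (m' \<circ> \<phi>) v = 0"
          using Q(2) by fastforce
      qed (use fin in auto)
      also have "\<dots> = (\<Sum>v\<in>verts D - Q - {c}. weight n (eps D' \<kappa>) m' (map_vert \<phi> v))"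
        by (rule sum.cong) (simp_all add: conv(2))
      also have "\<dots> = (\<Sum>v\<in>verts D' - {map_vert \<phi> c}. weight n (eps D' \<kappa>) m' v)"
        unfolding minus using inj_map
        by (subst sum.reindex) (auto intro: inj_on_subset)
      also have "\<dots> = nabla_J n (smoothing ko D' (map_vert \<phi> c))"
        using nabla_J_smoothing[OF D(2) c', of ko m' n] mix m m' kept by (simp add: \<kappa>_def)
      finally show ?thesis ..
    qed
    then show ?thesis unfolding contribution_def mix by (simp add: l)
  qed
  have "total P n ko D = (\<Sum>c\<in>verts D - Q. contribution P n ko D c)"
    unfolding total_def
  proof (rule sum.mono_neutral_right)
    have "contribution P n ko D v = 0" if "v \<in> Q" for v
      using Q(2)[OF that] by (auto simp: contribution_def mixed_def)
    then show "\<forall>v\<in>verts D - (verts D - Q). contribution P n ko D v = 0" by blast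
  qed (use fin in auto)
  also have "\<dots> = (\<Sum>c\<in>verts D - Q. contribution P n ko D' (map_vert \<phi> c))"
    by (rule sum.cong) (simp_all add: con)
  also have "\<dots> = total P n ko D'"
    unfolding total_def V using inj_map by (subst sum.reindex) auto
  finally show ?thesis ..
qed

lemma total_rename:
  assumes D: "link_diagram D" "link_diagram D'" and ren: "renames D D'"
  shows "total P n ko D' = total P n ko D"
proof -
  obtain g h where g: "inj_on g (arcs D)" "verts D' = map_vert g ` verts D"
      "\<And>x. x \<in> arcs D \<Longrightarrow> lab D' (g x) = lab D x"
    using ren unfolding renames_def by blast
  show ?thesis
    by (rule total_map_vert[where \<phi> = g and Q = "{}", OF D])
      (use g in \<open>auto intro: inj_on_subset simp: arcs_of_def\<close>)
qed

text \<open>The coarse diagram is an image of the fine one, so the map goes from \<open>D'\<close>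
  to \<open>D\<close>.\<close>

lemma total_subdivide:
  assumes D: "link_diagram D" "link_diagram D'" and sub: "subdivides D D'"
  shows "total P n ko D' = total P n ko D"
proof -
  obtain a b where ab: "a \<noteq> b" "Point a b \<in> verts D'"
      "verts D = map_vert (id(b := a)) ` (verts D' - {Point a b})"
      "\<And>x. x \<in> arcs D \<Longrightarrow> lab D x = lab D' x"
    using sub unfolding subdivides_def by blast
  let ?g = "id(b := a)"
  have M: "arcs_matched (verts D')" using D by (simp add: link_diagram_def)
  \<comment> \<open>Once the point is removed, \<open>a\<close> is no longer an incoming arc, so
    sending \<open>b\<close> to \<open>a\<close> stays injective on incoming arcs.\<close>
  have na: "x \<noteq> a" if "v \<in> verts D' - {Point a b}" "x \<in> set (ins v)" for v x
    using ins_unique[OF M _ ab(2), of v a] that by auto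
  have image: "?g x \<in> arcs D" if "v \<in> verts D' - {Point a b}" "x \<in> ends v" for v x
    using that unfolding ab(3) arcs_of_def by fastforce
  have lb: "lab D' b = lab D' a"
    using lab_passes[OF D(2) ab(2)] by simp
  \<comment> \<open>The arc \<open>b\<close> enters another vertex, whose image in \<open>D\<close>
    has \<open>a\<close> as an incoming arc.\<close>
  have "b \<in> arcs D'" using ab(2) by (force simp: arcs_of_def)
  then obtain w where w: "w \<in> verts D'" "b \<in> set (ins w)"
    using arcs_of_ins[OF M] by auto
  have "w \<noteq> Point a b" using w(2) ab(1) by auto
  then have "a \<in> arcs D"
    using image[of w b] w by simp
  moreover have "x \<in> {a, b} \<or> (\<exists>v\<in>verts D' - {Point a b}. x \<in> ends v)" if "x \<in> arcs D'" for x
    using that by (auto simp: arcs_of_def)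
  ultimately have lab: "lab D (?g x) = lab D' x" if "x \<in> arcs D'" for x
    using image[of _ x] ab(4)[of "?g x"] lb that by fastforce
  have "total P n ko D = total P n ko D'"
  proof (rule total_map_vert[where \<phi> = ?g and Q = "{Point a b}", OF D(2,1)])
    show "inj_on ?g (\<Union>v\<in>verts D' - {Point a b}. set (ins v))"
      using na by (auto simp: inj_on_def split: if_splits)
  qed (use ab lab in auto)
  then show ?thesis ..
qed

section \<open>Crossing changes\<close>

lemma switch_vert_simps [simp]:
  "ins (switch_vert v) = ins v" "outs (switch_vert v) = outs v"
  "classical (switch_vert v) = classical v" "sign (switch_vert v) = - sign v"
  "shifts \<epsilon> m (switch_vert v) = shifts \<epsilon> m v" "weight n \<epsilon> m (switch_vert v) = weight n \<epsilon> m v"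
  "joins m (switch_vert v) = joins m v"
  by (cases v; auto split: kind.splits)+

lemma switch_vert_over:
  assumes "classical v"
  shows "over_in (switch_vert v) = under_in v" "under_in (switch_vert v) = over_in v"
  using assms by (cases v; auto split: kind.splits; metis kind.exhaust)+

lemma shifts_uminus: "shifts (\<lambda>x. - \<epsilon> x) (\<lambda>x. - m x) v \<longleftrightarrow> shifts \<epsilon> m v"
  by (cases v) auto

lemma weight_uminus: "weight n (\<lambda>x. - \<epsilon> x) (\<lambda>x. - m x) v = - weight n \<epsilon> m v"
proof (cases v)
  case (Crossing k a b c d)
  have "bump n (- m a - m d - (- m b - m c)) = - bump n (m a + m d - (m b + m c))"
    unfolding bump_minus[symmetric] by (rule arg_cong[of _ _ "bump n"]) simp
  then show ?thesis using Crossing by simp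
qed simp

lemma joins_uminus: "joins (\<lambda>x. - m x) v \<longleftrightarrow> joins m v"
  by (cases v) auto

text \<open>At the switched crossing the sign and the component on top both change, so their product
  does not. The component that keeps its orientation changes under either convention; this negates
  \<open>nabla_J\<close>, and \<open>P\<close> is even. At the other crossings the same labelling
  serves both diagrams.\<close>

lemma total_crossing_change:
  assumes D: "link_diagram D" "link_diagram D'" and v: "v \<in> verts D" "classical v"
    and D': "D' = D\<lparr>verts := insert (switch_vert v) (verts D - {v})\<rparr>"
    and P: "\<And>x. P (- x) = P x"
  shows "total P n ko D' = total P n ko D"
proof -
  define R where "R = verts D - {v}"
  have M: "arcs_matched (verts D)" using D by (simp add: link_diagram_def)
  obtain x where x: "x \<in> set (ins v)" by (cases v) auto
  \<comment> \<open>Switching keeps the incoming arcs, which no other vertex of the diagram can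
    share.\<close>
  have nR: "switch_vert v \<notin> R"
    using ins_unique[OF M v(1), of "switch_vert v" x] x unfolding R_def by auto
  have lab: "lab D' = lab D" by (simp add: D')
  have V: "verts D = {v} \<union> R" "{v} \<inter> R = {}" "verts D' = {switch_vert v} \<union> R" "{switch_vert v} \<inter> R = {}"
    using v nR by (auto simp: R_def D')
  have eps: "eps D' = eps D" by (simp add: eps_def[abs_def] lab)
  have mix: "mixed D' (switch_vert v) \<longleftrightarrow> mixed D v"
    using v switch_vert_over[OF v(2)] by (auto simp: mixed_def lab)
  have "contribution P n ko D' (switch_vert v) = contribution P n ko D v"
  proof (cases "mixed D v")
    case True
    define \<kappa> \<kappa>' where "\<kappa> = kept_at ko D v" and "\<kappa>' = kept_at ko D' (switch_vert v)"
    have ne: "lab D (over_in v) \<noteq> lab D (under_in v)" using True by (simp add: mixed_def)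
    then have "\<kappa>' \<noteq> \<kappa>"
      using switch_vert_over[OF v(2)] by (auto simp: \<kappa>_def \<kappa>'_def kept_at_def lab)
    then have eps': "eps D' \<kappa>' = (\<lambda>x. - eps D \<kappa> x)"
      by (intro ext; cases \<kappa>; cases \<kappa>'; auto simp: eps_def lab; metis component.exhaust)
    obtain m where m: "cut_labelling (verts D) (eps D \<kappa>) v m"
      using exists_cut_labelling[OF D(1) v(1) True] by blast
    have minus: "verts D' - {switch_vert v} = R" "verts D - {v} = R"
      using V by auto
    have "cut_labelling (verts D') (eps D' \<kappa>') (switch_vert v) (\<lambda>x. - m x)"
      using m unfolding cut_labelling_def minus eps' by (simp add: shifts_uminus joins_uminus)
    then have "nabla_J n (smoothing ko D' (switch_vert v)) =
        (\<Sum>w\<in>R. weight n (\<lambda>x. - eps D \<kappa> x) (\<lambda>x. - m x) w)"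
      using nabla_J_smoothing[OF D(2), of "switch_vert v" ko "\<lambda>x. - m x" n] V(3) mix True minus eps'
      by (simp add: \<kappa>'_def)
    also have "\<dots> = - nabla_J n (smoothing ko D v)"
      using nabla_J_smoothing[OF D(1) v(1) True, of ko m n] m
      by (simp add: weight_uminus sum_negf minus \<kappa>_def)
    finally have "P (nabla_J n (smoothing ko D' (switch_vert v))) = P (nabla_J n (smoothing ko D v))"
      by (simp add: P)
    then show ?thesis
      using True mix ne switch_vert_over[OF v(2)]
      by (cases "lab D (over_in v)"; cases "lab D (under_in v)") (simp_all add: contribution_def lab)
  qed (simp add: contribution_def mix)
  then have T: "(\<Sum>c\<in>{switch_vert v}. contribution P n ko D' c) = (\<Sum>c\<in>{v}. contribution P n ko D c)"
    by simp
  show ?thesis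
    by (rule total_replace[where I = "{}", OF D V _ _ T]) (auto simp: lab eps)
qed

section \<open>Invariance\<close>

lemma total_virtual_move:
  assumes "virtual_move D D'" "link_diagram D" "link_diagram D'"
  shows "total P n ko D' = total P n ko D"
  using assms
proof (induction rule: virtual_move.induct)
  case (rename D D')
  then show ?case by (intro total_rename)
next
  case (subdivide D D')
  then show ?case by (intro total_subdivide)
next
  case (R1_right a b k l D D')
  then show ?case by (intro total_R1[where k = k and l = l]) auto
next
  case (R1_left a b k l D D')
  then show ?case by (intro total_R1[where k = k and l = l]) auto
next
  case (R2 s a b t c d k e f D' D)
  then show ?case by (intro total_R2)
next
  case (R3 k12 k13 k23 s1 s2 s3 p1 p2 p3 q1 q2 q3 m1 m2 m3 D D')
  then show ?case by (intro total_R3)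
qed

lemma total_flat_move:
  assumes "flat_move D D'" "link_diagram D" "link_diagram D'" "\<And>x. P (- x) = P x"
  shows "total P n ko D' = total P n ko D"
  using assms(1)
proof cases
  case virtual
  then show ?thesis using assms by (intro total_virtual_move)
next
  case (crossing_change v)
  then show ?thesis using assms by (intro total_crossing_change[where v = v]) auto
qed

text \<open>Equality along single moves in one direction suffices, because equality is symmetric and
  transitive.\<close>

lemma respects_equivalent_by:
  assumes "\<And>D D'. move D D' \<Longrightarrow> link_diagram D \<Longrightarrow> link_diagram D' \<Longrightarrow> f D' = f D"
  shows "f respects equivalent_by move"
proof (rule congruentI)
  fix D D' assume "(D, D') \<in> equivalent_by move"
  then have "equivclp (\<lambda>A B. link_diagram A \<and> link_diagram B \<and> move A B) D D'"
    by (simp add: equivalent_by_def)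
  then show "f D = f D'"
    by induction (auto dest: assms)
qed

theorem theorem5:
  fixes n k :: int and keep_over :: bool
  shows "span keep_over n k respects virtual_equiv \<and> fspan keep_over n k respects flat_equiv"
proof
  show "span keep_over n k respects virtual_equiv"
    unfolding virtual_equiv_def
  proof (rule respects_equivalent_by)
    fix D D' assume *: "virtual_move D D'" "link_diagram D" "link_diagram D'"
    then show "span keep_over n k D' = span keep_over n k D"
      using total_virtual_move[OF *] by (simp add: span_eq_total link_diagram_def)
  qed
  show "fspan keep_over n k respects flat_equiv"
    unfolding flat_equiv_def
  proof (rule respects_equivalent_by)
    fix D D' assume *: "flat_move D D'" "link_diagram D" "link_diagram D'"
    \<comment> \<open>The test function of \<open>fspan\<close> is even, as invariance under
      crossing changes demands.\<close>
    have "(of_bool (- x = k) + of_bool (- x = - k) :: int) = of_bool (x = k) + of_bool (x = - k)" for x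
      by auto
    from total_flat_move[where P = "\<lambda>x. of_bool (x = k) + of_bool (x = - k)", OF * this]
    show "fspan keep_over n k D' = fspan keep_over n k D"
      using * by (simp add: fspan_eq_total link_diagram_def)
  qed
qed

end
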